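(* Let $\bar H$ be the effective Hamiltonian of the subcritical case, defined in the context, and $(\bar x,\bar p)\in\mathbb{R}^n\times\mathbb{R}^n$. (i) $\bar H$ satisfies $$\bar H(\bar x,\bar p)=\lim_{\delta\to0}\ \sup_{\beta(\cdot)}\ \delta\int_0^{+\infty}\big(|\sigma(\bar x,y(t))^T\bar p|^2-|\beta(t)|^2\big)e^{-\delta t}\,dt,$$ where $\beta(\cdot)$ varies over measurable functions taking values in $\mathbb{R}^r$, $y(\cdot)$ is the trajectory of the control system $$\dot y(t)=2\tau(y(t))\sigma^T(\bar x,y(t))\bar p-2\tau(y(t))\beta(t),\quad t>0,\qquad y(0)=y,$$ and the limit is uniform with respect to the initial position $y\in\mathbb{R}^m$ of the system. (ii) If, in addition, $\tau(y)\sigma^T(x,y)=0$ for all $x\in\mathbb{R}^n$, $y\in\mathbb{R}^m$, then $$\bar H(\bar x,\bar p)=\max_{y\in\mathbb{R}^m}|\sigma^T(\bar x,y)\bar p|^2.$$ (iii) If $n=m=r=1$ and $\sigma\ge0$, then $$\bar H(\bar x,\bar p)=\left(\int_0^1\frac{\sigma(\bar x,y)}{\tau(y)}\,dy\right)^2\left(\int_0^1\frac1{\tau(y)}\,dy\right)^{-2}\bar p^2.$$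
   Context: Standing assumptions: $n,m,r\ge1$ are integers; $\sigma$ from $\mathbb{R}^n\times\mathbb{R}^m$ to the $n\times r$ real matrices is bounded, Lipschitz continuous in $(x,y)$ and $\mathbb{Z}^m$-periodic in $y$; $\tau$ from $\mathbb{R}^m$ to the $m\times r$ real matrices is locally Lipschitz and $\mathbb{Z}^m$-periodic; for some $\theta>0$, $|\tau^T(y)\xi|^2>\theta|\xi|^2$ for all $y\in\mathbb{R}^m$, $\xi\in\mathbb{R}^m\setminus\{0\}$. $\bar H(\bar x,\bar p)$ is the unique constant for which $$\bar H(\bar x,\bar p)-|\tau^T(y)D_yw(y)+\sigma^T(\bar x,y)\bar p|^2=0\quad\text{in }\mathbb{R}^m$$ has a $\mathbb{Z}^m$-periodic viscosity solution $w$. Controls $\beta$ are taken locally square integrable on $[0,\infty)$, so that the trajectory and the payoff (with values in $[-\infty,\infty)$) are defined. *)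

theory Defs
  imports "HOL-Analysis.Analysis"
begin

definition int_periodic :: "(real ^ 'm \<Rightarrow> 'b) \<Rightarrow> bool" where
  "int_periodic f \<longleftrightarrow> (\<forall>y k. (\<forall>i. k $ i \<in> \<int>) \<longrightarrow> f (y + k) = f y)"

definition locally_lipschitz :: "('a::metric_space \<Rightarrow> 'b::metric_space) \<Rightarrow> bool" where
  "locally_lipschitz f \<longleftrightarrow> (\<forall>y. \<exists>e>0. \<exists>L. L-lipschitz_on (ball y e) f)"

text \<open>
  Viscosity solutions of \<open>F(y, Dw(y)) = 0\<close> in the whole space, tested with \<open>C\<^sup>1\<close> functions
  \<open>\<phi>\<close> with gradient \<open>g\<close>.  The sign of \<open>F\<close> matters: \<open>F = 0\<close> and \<open>-F = 0\<close> have
  different viscosity solutions.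
\<close>

definition C1_with_gradient :: "('a::real_inner \<Rightarrow> real) \<Rightarrow> ('a \<Rightarrow> 'a) \<Rightarrow> bool" where
  "C1_with_gradient \<phi> g \<longleftrightarrow> (\<forall>y. GDERIV \<phi> y :> g y) \<and> continuous_on UNIV g"

definition viscosity_subsolution :: "('a::real_inner \<Rightarrow> 'a \<Rightarrow> real) \<Rightarrow> ('a \<Rightarrow> real) \<Rightarrow> bool" where
  "viscosity_subsolution F w \<longleftrightarrow> continuous_on UNIV w \<and>
     (\<forall>\<phi> g y. C1_with_gradient \<phi> g \<longrightarrow>
        (\<forall>\<^sub>F z in nhds y. w z - \<phi> z \<le> w y - \<phi> y) \<longrightarrow> F y (g y) \<le> 0)"

definition viscosity_supersolution :: "('a::real_inner \<Rightarrow> 'a \<Rightarrow> real) \<Rightarrow> ('a \<Rightarrow> real) \<Rightarrow> bool" where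
  "viscosity_supersolution F w \<longleftrightarrow> continuous_on UNIV w \<and>
     (\<forall>\<phi> g y. C1_with_gradient \<phi> g \<longrightarrow>
        (\<forall>\<^sub>F z in nhds y. w y - \<phi> y \<le> w z - \<phi> z) \<longrightarrow> F y (g y) \<ge> 0)"

definition viscosity_solution :: "('a::real_inner \<Rightarrow> 'a \<Rightarrow> real) \<Rightarrow> ('a \<Rightarrow> real) \<Rightarrow> bool" where
  "viscosity_solution F w \<longleftrightarrow> viscosity_subsolution F w \<and> viscosity_supersolution F w"

definition effective_Hamiltonian ::
  "(real ^ 'n \<Rightarrow> real ^ 'm \<Rightarrow> real ^ 'r ^ 'n) \<Rightarrow> (real ^ 'm \<Rightarrow> real ^ 'r ^ 'm) \<Rightarrow>
    real ^ 'n \<Rightarrow> real ^ 'n \<Rightarrow> real" where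
  "effective_Hamiltonian \<sigma> \<tau> x p = (THE H. \<exists>w. int_periodic w \<and>
     viscosity_solution
       (\<lambda>y q. H - (norm (transpose (\<tau> y) *v q + transpose (\<sigma> x y) *v p))\<^sup>2) w)"

definition admissible_control :: "(real \<Rightarrow> real ^ 'r) \<Rightarrow> bool" where
  "admissible_control \<beta> \<longleftrightarrow> \<beta> \<in> borel_measurable (lebesgue_on {0..}) \<and>
     (\<forall>T\<ge>0. integrable (lebesgue_on {0..T}) (\<lambda>t. (norm (\<beta> t))\<^sup>2))"

text \<open>
  Since the control is only locally square integrable, the differential equation is understood
  in the sense of Caratheodory, that is, in integrated form.  For continuous coefficients
  any such \<open>Y\<close> is continuous, so the integrand is Lebesgue integrable on bounded
  intervals and \<open>Y\<close> is locally absolutely continuous.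
\<close>

definition trajectory ::
  "(real ^ 'n \<Rightarrow> real ^ 'm \<Rightarrow> real ^ 'r ^ 'n) \<Rightarrow> (real ^ 'm \<Rightarrow> real ^ 'r ^ 'm) \<Rightarrow>
    real ^ 'n \<Rightarrow> real ^ 'n \<Rightarrow> (real \<Rightarrow> real ^ 'r) \<Rightarrow> real ^ 'm \<Rightarrow> (real \<Rightarrow> real ^ 'm) \<Rightarrow> bool" where
  "trajectory \<sigma> \<tau> x p \<beta> y0 Y \<longleftrightarrow> (\<forall>t\<ge>0.
     ((\<lambda>s. 2 *\<^sub>R (\<tau> (Y s) *v (transpose (\<sigma> x (Y s)) *v p)) - 2 *\<^sub>R (\<tau> (Y s) *v \<beta> s))
        has_integral (Y t - y0)) {0..t})"

text \<open>
  Extended Lebesgue integral, the difference of the integrals of the positive and the negative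
  part (\<open>ennreal\<close> truncates negative numbers to 0).  It is meaningful when at least one of
  them is finite.
\<close>

definition extended_integral :: "'a measure \<Rightarrow> ('a \<Rightarrow> real) \<Rightarrow> ereal" where
  "extended_integral M f =
     enn2ereal (\<integral>\<^sup>+t. ennreal (f t) \<partial>M) - enn2ereal (\<integral>\<^sup>+t. ennreal (- f t) \<partial>M)"

definition discounted_payoff ::
  "(real ^ 'n \<Rightarrow> real ^ 'm \<Rightarrow> real ^ 'r ^ 'n) \<Rightarrow> real ^ 'n \<Rightarrow> real ^ 'n \<Rightarrow> real \<Rightarrow>
    (real \<Rightarrow> real ^ 'r) \<Rightarrow> (real \<Rightarrow> real ^ 'm) \<Rightarrow> ereal" where
  "discounted_payoff \<sigma> x p \<delta> \<beta> Y = ereal \<delta> * extended_integral (lebesgue_on {0..})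
     (\<lambda>t. ((norm (transpose (\<sigma> x (Y t)) *v p))\<^sup>2 - (norm (\<beta> t))\<^sup>2) * exp (- \<delta> * t))"

text \<open>
  When the coefficients are bounded and Lipschitz, each admissible control has a trajectory, which
  is unique on \<open>[0,\<infinity>)\<close>, so the supremum over pairs is the supremum over controls.
\<close>

definition discounted_value ::
  "(real ^ 'n \<Rightarrow> real ^ 'm \<Rightarrow> real ^ 'r ^ 'n) \<Rightarrow> (real ^ 'm \<Rightarrow> real ^ 'r ^ 'm) \<Rightarrow>
    real ^ 'n \<Rightarrow> real ^ 'n \<Rightarrow> real \<Rightarrow> real ^ 'm \<Rightarrow> ereal" where
  "discounted_value \<sigma> \<tau> x p \<delta> y0 =
     (SUP (\<beta>, Y) \<in> {(\<beta>, Y). admissible_control \<beta> \<and> trajectory \<sigma> \<tau> x p \<beta> y0 Y}.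
        discounted_payoff \<sigma> x p \<delta> \<beta> Y)"

end

theory Submission imports Defs begin

text \<open>
  Write \<open>b(y) = \<sigma>\<^sup>T(x,y) p\<close> for the given \<open>x\<close> and \<open>p\<close>.  A trajectory \<open>Y\<close> with control \<open>\<beta>\<close>
  moves with velocity \<open>vel = 2\<tau>(Y)(b(Y) - \<beta>)\<close> and earns \<open>gain = |b(Y)|\<^sup>2 - |\<beta>|\<^sup>2\<close> per unit time.
  Completing the square gives
  \<open>gain + q \<bullet> vel = |\<tau>\<^sup>T q + b|\<^sup>2 - |\<beta> + \<tau>\<^sup>T q|\<^sup>2\<close>, so the Hamiltonian of the cell problem is the
  largest value of \<open>gain + q \<bullet> vel\<close> over all controls (\<open>gain_plus_inner_vel\<close>), and the theorem is
  a statement about the optimal gain.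

  Since \<open>\<tau>\<tau>\<^sup>T\<close> is invertible, every straight line is a trajectory at controlled cost, and up to a
  translation in \<open>\<int>\<^sup>m\<close> any two points are joined in unit time at bounded cost.  Hence the
  largest gain \<open>M(T)\<close> up to time \<open>T\<close> is subadditive and, up to a constant, superadditive.  It
  therefore differs from \<open>c T\<close> by a bounded amount, where \<open>c = inf M(T)/T\<close> is the number
  \<open>crit\<close>: no trajectory gains more than \<open>c T\<close> plus a constant (\<open>excess_le\<close>), and from every
  point some trajectory gains at least \<open>c T\<close> minus a constant (\<open>excess_ge\<close>).

  This \<open>c\<close> is the effective Hamiltonian.  Existence: the supremum of \<open>gain - c\<close>, integrated up to
  horizons \<open>t \<ge> T\<close>, decreases uniformly to a Lipschitz periodic function as \<open>T\<close> grows; the limit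
  (\<open>corrector\<close>) satisfies the dynamic programming principle with constant \<open>c\<close>, and this makes it
  a viscosity solution.  Uniqueness is a comparison principle (\<open>comparison\<close>), proved by doubling
  the variables; the coercivity of the Hamiltonian keeps the gradients of the test functions
  bounded.

  For the limit formula, the second mean value theorem rewrites a discounted integral of \<open>gain - c\<close> by means of
  two undiscounted ones, which are bounded.  Every discounted payoff is therefore at most \<open>c\<close>
  plus a multiple of \<open>\<delta>\<close>, and some payoff is at least \<open>c\<close> minus a multiple of \<open>\<delta>\<close>, whatever the
  initial point.  If \<open>\<tau>\<sigma>\<^sup>T = 0\<close>, the velocity \<open>2\<tau>b\<close> of the control \<open>0\<close> vanishes, so a trajectory
  may rest at a maximum point of \<open>|b|\<^sup>2\<close>, and nothing earns more.  In dimension one, the equation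
  \<open>\<tau> w' + b = C\<close> has a periodic classical solution for exactly one constant \<open>C\<close>, and \<open>C\<^sup>2 = c\<close> by
  uniqueness.
\<close>

section \<open>Matrices acting on vectors\<close>


text \<open>
  The Hamiltonian is written with \<open>transpose A *v q\<close>; the default simplification to \<open>q v* A\<close>
  would hide the adjoint relation.
\<close>

declare transpose_matrix_vector [simp del]

lemma bounded_bilinear_matrix_vector_mult:
  "bounded_bilinear (\<lambda>(A :: real ^ 'r ^ 'm) x. A *v x)"
  unfolding bilinear_conv_bounded_bilinear[symmetric] bilinear_def
  by (auto intro!: linearI simp: matrix_vector_right_distrib matrix_vector_mult_add_rdistrib
      scaleR_matrix_vector_assoc[symmetric] matrix_vector_mult_scaleR)

lemmas continuous_on_matrix_vector_mult [continuous_intros] =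
  bounded_bilinear.continuous_on[OF bounded_bilinear_matrix_vector_mult]

lemma continuous_on_transpose [continuous_intros]:
  fixes f :: "'a::topological_space \<Rightarrow> real ^ 'r ^ 'm"
  assumes "continuous_on S f"
  shows "continuous_on S (\<lambda>x. transpose (f x))"
proof -
  have "linear (transpose :: real ^ 'r ^ 'm \<Rightarrow> _)"
    by (rule linearI) (simp_all add: transpose_def vec_eq_iff)
  then have "continuous_on UNIV (transpose :: real ^ 'r ^ 'm \<Rightarrow> _)"
    by (rule linear_continuous_on[OF linear_conv_bounded_linear[THEN iffD1]])
  then show ?thesis
    using continuous_on_compose2 assms by blast
qed

lemma inner_transpose_matrix_vector:
  fixes A :: "real ^ 'r ^ 'm"
  shows "q \<bullet> (A *v e) = (transpose A *v q) \<bullet> e"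
  by (metis dot_lmul_matrix transpose_matrix_vector)

section \<open>Periodic functions\<close>

abbreviation unit_cube :: "(real ^ 'm) set" where
  "unit_cube \<equiv> cbox 0 1"

lemma cube_translate:
  fixes y :: "real ^ 'm"
  obtains k where "\<And>i. k $ i \<in> \<int>" "y + k \<in> unit_cube"
proof
  let ?k = "(\<chi> i. - of_int \<lfloor>y $ i\<rfloor>) :: real ^ 'm"
  show "?k $ i \<in> \<int>" for i by simp
  show "y + ?k \<in> unit_cube"
    by (simp add: mem_box_cart) linarith
qed

lemma int_periodicD:
  assumes "int_periodic f" "\<And>i. k $ i \<in> \<int>"
  shows "f (y + k) = f y"
  using assms unfolding int_periodic_def by blast

lemma int_periodic_cube:
  assumes "int_periodic f"
  obtains z where "z \<in> unit_cube" "f z = f y"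
  by (metis assms cube_translate int_periodicD)

lemma int_periodic_range:
  assumes "int_periodic f"
  shows "range f = f ` unit_cube"
proof -
  have "f y \<in> f ` unit_cube" for y
    using int_periodic_cube[OF assms] by (metis imageI)
  then show ?thesis by auto
qed

lemma int_periodic_compact_range:
  fixes f :: "real ^ 'm \<Rightarrow> 'b::metric_space"
  assumes "int_periodic f" "continuous_on UNIV f"
  shows "compact (range f)"
  unfolding int_periodic_range[OF assms(1)]
  by (meson assms(2) compact_cbox compact_continuous_image continuous_on_subset subset_UNIV)

lemma int_periodic_norm_bound:
  fixes f :: "real ^ 'm \<Rightarrow> 'b::real_normed_vector"
  assumes "int_periodic f" "continuous_on UNIV f"
  obtains B where "B > 0" "\<And>y. norm (f y) \<le> B"
proof -
  have "bounded (range f)"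
    using compact_imp_bounded int_periodic_compact_range[OF assms] by blast
  then show ?thesis
    using that unfolding bounded_pos by auto
qed

text \<open>
  Of two close points one may be translated into the unit cube, and the other one then lies in
  the compact cube enlarged by one on each side.
\<close>

lemma int_periodic_uniformly_continuous:
  fixes f :: "real ^ 'm \<Rightarrow> 'b::metric_space"
  assumes "int_periodic f" "continuous_on UNIV f" "\<epsilon> > 0"
  obtains d where "d > 0" "\<And>x y. dist x y < d \<Longrightarrow> dist (f x) (f y) < \<epsilon>"
proof -
  let ?K = "cbox (-1) 2 :: (real ^ 'm) set"
  have "uniformly_continuous_on ?K f"
    by (meson assms(2) compact_cbox compact_uniformly_continuous continuous_on_subset subset_UNIV)
  then obtain d where d: "d > 0" "\<And>x y. \<lbrakk>x \<in> ?K; y \<in> ?K; dist x y < d\<rbrakk> \<Longrightarrow> dist (f x) (f y) < \<epsilon>"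
    unfolding uniformly_continuous_on_def using assms(3) by metis
  show ?thesis
  proof
    show "min d 1 > 0" using d by simp
    fix x y :: "real ^ 'm" assume xy: "dist x y < min d 1"
    obtain k where k: "\<And>i. k $ i \<in> \<int>" "x + k \<in> unit_cube" using cube_translate by blast
    have "\<bar>(x - y) $ i\<bar> < 1" for i
      using component_le_norm_cart[of "x - y" i] xy by (simp add: dist_norm)
    then have *: "\<bar>x $ i - y $ i\<bar> < 1" for i by simp
    have "y + k \<in> ?K"
      unfolding mem_box_cart
    proof
      fix i
      show "(- 1) $ i \<le> (y + k) $ i \<and> (y + k) $ i \<le> 2 $ i"
        using *[of i] k(2) unfolding mem_box_cart by (auto dest!: spec[of _ i])
    qed
    moreover have "x + k \<in> ?K"
      unfolding mem_box_cart
    proof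
      fix i
      show "(- 1) $ i \<le> (x + k) $ i \<and> (x + k) $ i \<le> 2 $ i"
        using k(2) unfolding mem_box_cart by (auto dest!: spec[of _ i])
    qed
    ultimately have "dist (f (x + k)) (f (y + k)) < \<epsilon>"
      using d(2) xy by simp
    then show "dist (f x) (f y) < \<epsilon>"
      using int_periodicD[OF assms(1) k(1)] by simp
  qed
qed

section \<open>Admissible controls as Henstock--Kurzweil integrable functions\<close>

text \<open>
  Restriction, translation and concatenation in time are directly available for gauge integrals,
  and the measurability on the half line follows from integrability on each bounded interval.
  Conversely \<open>|\<beta>| \<le> 1 + |\<beta>|\<^sup>2\<close> makes a measurable \<open>\<beta>\<close> integrable.
\<close>

lemma admissible_control_iff:
  fixes \<beta> :: "real \<Rightarrow> real ^ 'r"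
  shows "admissible_control \<beta> \<longleftrightarrow>
    (\<forall>T\<ge>0. \<beta> integrable_on {0..T} \<and> (\<lambda>t. (norm (\<beta> t))\<^sup>2) integrable_on {0..T})"
    (is "?L \<longleftrightarrow> ?R")
proof
  assume L: ?L
  show ?R
  proof (intro allI impI)
    fix T :: real assume T: "T \<ge> 0"
    have int: "integrable (lebesgue_on {0..T}) (\<lambda>t. (norm (\<beta> t))\<^sup>2)"
      using L T unfolding admissible_control_def by blast
    have sq: "(\<lambda>t. (norm (\<beta> t))\<^sup>2) integrable_on {0..T}"
      using integrable_on_lebesgue_on[OF int] by simp
    have "\<beta> \<in> borel_measurable (lebesgue_on {0..T})"
    proof (rule measurable_restrict_mono)
      show "\<beta> \<in> borel_measurable (lebesgue_on {0..})"
        using L unfolding admissible_control_def by blast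
    qed auto
    then have "\<beta> integrable_on {0..T}"
    proof (rule measurable_bounded_by_integrable_imp_integrable)
      show "(\<lambda>t. 1 + (norm (\<beta> t))\<^sup>2) integrable_on {0..T}"
        using sq by (intro integrable_add) auto
      show "norm (\<beta> t) \<le> 1 + (norm (\<beta> t))\<^sup>2" for t
        using self_le_power[of "norm (\<beta> t)" 2] zero_le_power2[of "norm (\<beta> t)"]
        by (cases "norm (\<beta> t) \<ge> 1") linarith+
    qed simp
    with sq show "\<beta> integrable_on {0..T} \<and> (\<lambda>t. (norm (\<beta> t))\<^sup>2) integrable_on {0..T}" by simp
  qed
next
  assume R: ?R
  have sq: "integrable (lebesgue_on {0..T}) (\<lambda>t. (norm (\<beta> t))\<^sup>2)" if "T \<ge> 0" for T
    using R that by (intro absolutely_integrable_imp_integrable nonnegative_absolutely_integrable_1) auto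
  have "(\<lambda>t. if t \<in> {0..real n} then \<beta> t else 0) \<in> borel_measurable lebesgue" for n
    using integrable_imp_measurable[of \<beta> "{0..real n}"] R
    by (subst borel_measurable_if) auto
  moreover have "(\<lambda>n. if t \<in> {0..real n} then \<beta> t else 0) \<longlonglongrightarrow> (if t \<in> {0..} then \<beta> t else 0)" for t
  proof (rule tendsto_eventually)
    show "\<forall>\<^sub>F n in sequentially. (if t \<in> {0..real n} then \<beta> t else 0) = (if t \<in> {0..} then \<beta> t else 0)"
      using eventually_ge_at_top[of "nat \<lceil>t\<rceil>"]
      by eventually_elim (auto simp: nat_le_iff ceiling_le_iff)
  qed
  ultimately have "(\<lambda>t. if t \<in> {0..} then \<beta> t else 0) \<in> borel_measurable lebesgue"
    by (rule borel_measurable_LIMSEQ_metric)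
  then have "\<beta> \<in> borel_measurable (lebesgue_on {0..})"
    by (subst (asm) borel_measurable_if) auto
  with sq show ?L unfolding admissible_control_def by blast
qed

section \<open>Extended integrals over the half line\<close>

text \<open>
  Monotone convergence applies to the positive and to the negative part.  Only the former is
  required to be finite, so the limit may be \<open>-\<infinity>\<close>; finiteness on one side is what lets the
  difference pass to the limit.
\<close>

lemma extended_integral_LIMSEQ:
  fixes f :: "real \<Rightarrow> real"
  assumes int: "\<And>n :: nat. f absolutely_integrable_on {0..real n}"
    and pos: "(\<integral>\<^sup>+t. ennreal (f t) \<partial>lebesgue_on {0..}) < \<infinity>"
  shows "(\<lambda>n. ereal (integral {0..real n} f)) \<longlonglongrightarrow> extended_integral (lebesgue_on {0..}) f"
proof -
  have lim: "(\<lambda>n. ennreal (integral {0..real n} (\<lambda>t. max (g t) 0))) \<longlonglongrightarrow> (\<integral>\<^sup>+t. ennreal (g t) \<partial>lebesgue_on {0..})"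
    if g: "\<And>n :: nat. g absolutely_integrable_on {0..real n}" for g :: "real \<Rightarrow> real"
  proof -
    let ?h = "\<lambda>n t. ennreal (max (g t) 0) * indicator {0..real n} t"
    have m: "(\<lambda>t. max (g t) 0) absolutely_integrable_on {0..real n}" for n :: nat
      using absolutely_integrable_max_1[OF g[of n], of "\<lambda>_. 0"] by simp
    have int: "((\<lambda>t. max (g t) 0) has_integral integral {0..real n} (\<lambda>t. max (g t) 0)) {0..real n}" for n :: nat
      using m[of n] by (simp add: absolutely_integrable_on_def integrable_integral)
    have "integral\<^sup>N lebesgue (?h n) = ennreal (integral {0..real n} (\<lambda>t. max (g t) 0))" for n
      unfolding nn_integral_completion by (rule nn_integral_has_integral_lebesgue'[OF _ int]) simp
    moreover have "(\<lambda>n. integral\<^sup>N lebesgue (?h n)) \<longlonglongrightarrow> (\<integral>\<^sup>+t. ennreal (g t) * indicator {0..} t \<partial>lebesgue)"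
    proof (rule nn_integral_LIMSEQ)
      show "incseq ?h"
        by (auto simp: incseq_def le_fun_def indicator_def)
      fix n
      have "(\<lambda>t. max (g t) 0 * indicator {0..real n} t) \<in> borel_measurable lebesgue"
        using m[of n] unfolding set_integrable_def by (auto simp: mult.commute dest: borel_measurable_integrable)
      then have "(\<lambda>t. ennreal (max (g t) 0 * indicator {0..real n} t)) \<in> borel_measurable lebesgue" by simp
      also have "(\<lambda>t. ennreal (max (g t) 0 * indicator {0..real n} t)) = ?h n"
        by (auto simp: fun_eq_iff indicator_def)
      finally show "?h n \<in> borel_measurable lebesgue" .
    next
      fix t :: real
      show "(\<lambda>n. ?h n t) \<longlonglongrightarrow> ennreal (g t) * indicator {0..} t"
      proof (rule tendsto_eventually)
        show "\<forall>\<^sub>F n in sequentially. ?h n t = ennreal (g t) * indicator {0..} t"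
          using eventually_ge_at_top[of "nat \<lceil>t\<rceil>"]
          by eventually_elim
            (auto simp: nat_le_iff ceiling_le_iff indicator_def max_def ennreal_neg)
      qed
    qed
    ultimately show ?thesis by (simp add: nn_integral_restrict_space)
  qed
  let ?P = "\<integral>\<^sup>+t. ennreal (f t) \<partial>lebesgue_on {0..}" and ?N = "\<integral>\<^sup>+t. ennreal (- f t) \<partial>lebesgue_on {0..}"
  have "(\<lambda>t. - f t) absolutely_integrable_on {0..real n}" for n :: nat
    using int[of n] by (simp add: absolutely_integrable_on_def integrable_neg_iff)
  note neg = this
  note N = lim[OF neg]
  have "(\<lambda>n. enn2ereal (ennreal (integral {0..real n} (\<lambda>t. max (f t) 0))) -
      enn2ereal (ennreal (integral {0..real n} (\<lambda>t. max (- f t) 0)))) \<longlonglongrightarrow> enn2ereal ?P - enn2ereal ?N"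
  proof (rule tendsto_diff_ereal_general)
    show "\<not> (enn2ereal ?P = \<infinity> \<and> enn2ereal ?N = \<infinity> \<or> enn2ereal ?P = - \<infinity> \<and> enn2ereal ?N = - \<infinity>)"
      using pos enn2ereal_nonneg[of ?P] by (auto simp del: enn2ereal_nonneg)
  qed (use lim[OF int] N in \<open>simp_all del: enn2ereal_ennreal\<close>)
  moreover have "enn2ereal (ennreal (integral {0..real n} (\<lambda>t. max (f t) 0))) -
      enn2ereal (ennreal (integral {0..real n} (\<lambda>t. max (- f t) 0))) = ereal (integral {0..real n} f)" for n
  proof -
    have i: "(\<lambda>t. max (f t) 0) integrable_on {0..real n}" "(\<lambda>t. max (- f t) 0) integrable_on {0..real n}"
      using absolutely_integrable_max_1[OF int[of n], of "\<lambda>_. 0"]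
        absolutely_integrable_max_1[OF neg[of n], of "\<lambda>_. 0"]
      by (simp_all add: absolutely_integrable_on_def)
    have "integral {0..real n} (\<lambda>t. max (f t) 0) - integral {0..real n} (\<lambda>t. max (- f t) 0) = integral {0..real n} f"
      by (subst integral_diff[symmetric]) (auto simp: i intro!: integral_cong)
    moreover have "0 \<le> integral {0..real n} (\<lambda>t. max (f t) 0)" "0 \<le> integral {0..real n} (\<lambda>t. max (- f t) 0)"
      by (rule integral_nonneg; simp add: i)+
    ultimately show ?thesis by simp
  qed
  ultimately show ?thesis unfolding extended_integral_def by simp
qed

lemma abs_ereal_diff_less:
  assumes "ereal (h - A) \<le> v" "v \<le> ereal (h + A)" "A < \<epsilon>"
  shows "\<bar>v - ereal h\<bar> < ereal \<epsilon>"
  using assms by (cases v) (auto simp: abs_less_iff)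

section \<open>The control problem\<close>

text \<open>
  Here \<open>b(y)\<close> stands for \<open>\<sigma>\<^sup>T(x,y) p\<close> with \<open>x\<close> and \<open>p\<close> fixed.
\<close>

locale cell_problem =
  fixes b :: "real ^ 'm \<Rightarrow> real ^ 'r" and \<tau> :: "real ^ 'm \<Rightarrow> real ^ 'r ^ 'm" and \<theta> :: real
  assumes b_continuous: "continuous_on UNIV b"
    and b_periodic: "int_periodic b"
    and \<tau>_continuous: "continuous_on UNIV \<tau>"
    and \<tau>_periodic: "int_periodic \<tau>"
    and \<theta>_pos: "\<theta> > 0"
    and nondegenerate: "\<xi> \<noteq> 0 \<Longrightarrow> (norm (transpose (\<tau> y) *v \<xi>))\<^sup>2 > \<theta> * (norm \<xi>)\<^sup>2"
begin

definition vel :: "real ^ 'm \<Rightarrow> real ^ 'r \<Rightarrow> real ^ 'm" where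
  "vel y e = 2 *\<^sub>R (\<tau> y *v b y) - 2 *\<^sub>R (\<tau> y *v e)"

definition gain :: "real ^ 'm \<Rightarrow> real ^ 'r \<Rightarrow> real" where
  "gain y e = (norm (b y))\<^sup>2 - (norm e)\<^sup>2"

definition ham :: "real ^ 'm \<Rightarrow> real ^ 'm \<Rightarrow> real" where
  "ham y q = (norm (transpose (\<tau> y) *v q + b y))\<^sup>2"

text \<open>
  Completing the square: \<open>ham y q\<close> is the maximum over \<open>e\<close> of \<open>gain y e + q \<bullet> vel y e\<close>, attained at
  \<open>e = - \<tau>\<^sup>T q\<close>.  All links between the control problem and the equation go through this identity.
\<close>

lemma gain_plus_inner_vel:
  "gain y e + q \<bullet> vel y e = ham y q - (norm (e + transpose (\<tau> y) *v q))\<^sup>2"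
proof -
  let ?u = "transpose (\<tau> y) *v q"
  have "q \<bullet> vel y e = 2 * (?u \<bullet> b y) - 2 * (?u \<bullet> e)"
    unfolding vel_def inner_diff_right inner_scaleR_right inner_transpose_matrix_vector by simp
  then show ?thesis
    unfolding gain_def ham_def power2_norm_eq_inner inner_add_left inner_add_right
    using inner_commute[of ?u "b y"] inner_commute[of ?u e] by linarith
qed

lemma vel_eq: "vel y e = 2 *\<^sub>R (\<tau> y *v (b y - e))"
  by (simp add: vel_def matrix_vector_mult_diff_distrib scaleR_right_diff_distrib)

definition b_bound where "b_bound = (SOME C. C > 0 \<and> (\<forall>y. norm (b y) \<le> C))"

lemma b_bound_pos: "b_bound > 0" and norm_b_le: "norm (b y) \<le> b_bound"
proof -
  have "\<exists>C. C > 0 \<and> (\<forall>y. norm (b y) \<le> C)"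
    using int_periodic_norm_bound[OF b_periodic b_continuous] by metis
  from someI_ex[OF this] show "b_bound > 0" "norm (b y) \<le> b_bound" unfolding b_bound_def by auto
qed

definition \<tau>_bound where "\<tau>_bound = (SOME C. C > 0 \<and> (\<forall>y e q. norm (\<tau> y *v e) \<le> C * norm e \<and>
  norm (transpose (\<tau> y) *v q) \<le> C * norm q))"

lemma \<tau>_bound_pos: "\<tau>_bound > 0"
  and norm_\<tau>_le: "norm (\<tau> y *v e) \<le> \<tau>_bound * norm e"
  and norm_\<tau>_transpose_le: "norm (transpose (\<tau> y) *v q) \<le> \<tau>_bound * norm q"
proof -
  obtain C where C: "C > 0" "\<And>y. norm (\<tau> y) \<le> C"
    using int_periodic_norm_bound[OF \<tau>_periodic \<tau>_continuous] by metis
  obtain D where D: "D > 0" "\<And>(A :: real ^ 'r ^ 'm) x. norm (A *v x) \<le> norm A * norm x * D"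
    using bounded_bilinear.pos_bounded[OF bounded_bilinear_matrix_vector_mult] by blast
  have "norm (\<tau> y *v e) \<le> C * D * norm e" for y e
  proof -
    have "norm (\<tau> y *v e) \<le> norm (\<tau> y) * norm e * D" by (rule D)
    also have "\<dots> \<le> C * norm e * D"
      using C(2)[of y] D(1) by (intro mult_right_mono) auto
    finally show ?thesis by (simp add: ac_simps)
  qed note 1 = this
  have 2: "norm (transpose (\<tau> y) *v q) \<le> C * D * norm q" for y q
  proof -
    let ?u = "transpose (\<tau> y) *v q"
    have "norm ?u * norm ?u = q \<bullet> (\<tau> y *v ?u)"
      by (simp add: inner_transpose_matrix_vector power2_norm_eq_inner flip: power2_eq_square)
    also have "\<dots> \<le> norm q * (C * D * norm ?u)"
      using norm_cauchy_schwarz 1 by (meson mult_left_mono norm_ge_zero order_trans)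
    finally have "norm ?u * norm ?u \<le> (C * D * norm q) * norm ?u" by (simp add: ac_simps)
    then show ?thesis
      using C(1) D(1) by (cases "norm ?u = 0") (auto simp: mult_le_cancel_right)
  qed
  have "\<exists>C. C > 0 \<and> (\<forall>y e q. norm (\<tau> y *v e) \<le> C * norm e \<and>
      norm (transpose (\<tau> y) *v q) \<le> C * norm q)"
    using 1 2 C(1) D(1) by (intro exI[of _ "C * D"]) auto
  from someI_ex[OF this]
  show "\<tau>_bound > 0" "norm (\<tau> y *v e) \<le> \<tau>_bound * norm e" "norm (transpose (\<tau> y) *v q) \<le> \<tau>_bound * norm q"
    unfolding \<tau>_bound_def by blast+
qed

lemma norm_vel_le: "norm (vel y e) \<le> 2 * \<tau>_bound * norm (b y - e)"
  using norm_\<tau>_le[of y "b y - e"] by (simp add: vel_eq)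

lemma gain_le: "gain y e \<le> b_bound\<^sup>2"
  using power_mono[OF norm_b_le[of y] norm_ge_zero, of 2] zero_le_power2[of "norm e"]
  unfolding gain_def by linarith

section \<open>Runs of the control system\<close>

text \<open>
  A run is an admissible control together with a trajectory; the initial point is \<open>Y 0\<close>.
\<close>

definition run :: "(real \<Rightarrow> real ^ 'r) \<Rightarrow> (real \<Rightarrow> real ^ 'm) \<Rightarrow> bool" where
  "run \<beta> Y \<longleftrightarrow>
    (\<forall>T\<ge>0. \<beta> integrable_on {0..T} \<and> (\<lambda>t. (norm (\<beta> t))\<^sup>2) integrable_on {0..T} \<and>
      ((\<lambda>t. vel (Y t) (\<beta> t)) has_integral (Y T - Y 0)) {0..T})"

definition total_gain :: "(real \<Rightarrow> real ^ 'r) \<Rightarrow> (real \<Rightarrow> real ^ 'm) \<Rightarrow> real \<Rightarrow> real" where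
  "total_gain \<beta> Y T = integral {0..T} (\<lambda>t. gain (Y t) (\<beta> t))"

lemma run_continuous:
  assumes "run \<beta> Y"
  shows "continuous_on {0..T} Y"
proof -
  let ?f = "\<lambda>t. vel (Y t) (\<beta> t)"
  have eq: "Y t = Y 0 + integral {0..t} ?f" if "t \<ge> 0" for t
    using assms that integral_unique[of ?f "Y t - Y 0" "{0..t}"] unfolding run_def by auto
  have "continuous_on {0..T} (\<lambda>t. Y 0 + integral {0..t} ?f)"
  proof (cases "T \<ge> 0")
    case True
    then have "?f integrable_on {0..T}" using assms unfolding run_def by blast
    then show ?thesis by (intro continuous_intros indefinite_integral_continuous_1)
  qed auto
  then show ?thesis
    by (rule continuous_on_eq) (simp add: eq[symmetric])
qed

lemma run_comp_integrable:
  fixes f :: "real ^ 'm \<Rightarrow> real"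
  assumes "run \<beta> Y" "continuous_on UNIV f"
  shows "(\<lambda>t. f (Y t)) integrable_on {0..T}"
  using run_continuous[OF assms(1)] assms(2)
  by (intro integrable_continuous_interval continuous_on_compose2[OF assms(2)]) auto

lemma gain_integrable:
  assumes "run \<beta> Y" "T \<ge> 0"
  shows "(\<lambda>t. gain (Y t) (\<beta> t)) integrable_on {0..T}"
proof -
  have "(\<lambda>t. (norm (b (Y t)))\<^sup>2) integrable_on {0..T}"
    using b_continuous by (intro run_comp_integrable[OF assms(1)] continuous_intros)
  then show ?thesis
    using assms unfolding gain_def run_def by (intro integrable_diff) auto
qed

lemma gain_integrable_sub:
  assumes "run \<beta> Y" "0 \<le> s"
  shows "(\<lambda>t. gain (Y t) (\<beta> t)) integrable_on {s..T}"
proof (cases "s \<le> T")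
  case True
  show ?thesis
    by (rule integrable_on_subinterval[OF gain_integrable[OF assms(1), of T]]) (use assms True in auto)
qed auto

lemma run_shift:
  assumes "run \<beta> Y" "s \<ge> 0"
  shows "run (\<lambda>t. \<beta> (t + s)) (\<lambda>t. Y (t + s))"
  unfolding run_def
proof (intro allI impI conjI)
  fix T :: real assume T: "T \<ge> 0"
  have sub: "f integrable_on {s..s + T}" if "f integrable_on {0..s + T}"
    for f :: "real \<Rightarrow> 'x::euclidean_space"
    by (rule integrable_on_subinterval[OF that]) (use assms in auto)
  have shift: "(\<lambda>t. f (t + s)) integrable_on {0..T}" if "f integrable_on {s..s + T}"
    for f :: "real \<Rightarrow> 'x::euclidean_space"
    using integrable_shift_cbox[of f s "s + T" s] that by simp
  have sT: "s + T \<ge> 0" using assms T by simp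
  show "(\<lambda>t. \<beta> (t + s)) integrable_on {0..T}"
    and "(\<lambda>t. (norm (\<beta> (t + s)))\<^sup>2) integrable_on {0..T}"
    using shift[OF sub, of \<beta>] shift[OF sub, of "\<lambda>t. (norm (\<beta> t))\<^sup>2"] assms(1) sT
    unfolding run_def by auto
  let ?f = "\<lambda>t. vel (Y t) (\<beta> t)"
  have 1: "(?f has_integral (Y (s + T) - Y 0)) {0..s + T}" and 2: "(?f has_integral (Y s - Y 0)) {0..s}"
    using assms sT unfolding run_def by auto
  have "?f integrable_on {s..s + T}" by (rule sub[OF has_integral_integrable[OF 1]])
  then obtain I where I: "(?f has_integral I) {s..s + T}" by blast
  have "(?f has_integral (Y s - Y 0 + I)) {0..s + T}"
    by (rule has_integral_combine[OF _ _ 2 I]) (use assms T in auto)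
  then have "I = Y (s + T) - Y s"
    using has_integral_unique[OF 1] by (simp add: algebra_simps)
  with has_integral_shift_real_ivl[OF I, of s]
  show "((\<lambda>t. vel (Y (t + s)) (\<beta> (t + s))) has_integral (Y (T + s) - Y (0 + s))) {0..T}"
    by (simp add: add.commute)
qed

lemma total_gain_shift:
  assumes "run \<beta> Y" "s \<ge> 0" "T \<ge> 0"
  shows "total_gain (\<lambda>t. \<beta> (t + s)) (\<lambda>t. Y (t + s)) T = total_gain \<beta> Y (s + T) - total_gain \<beta> Y s"
proof -
  let ?f = "\<lambda>t. gain (Y t) (\<beta> t)"
  have "integral {0..s} ?f + integral {s..s + T} ?f = integral {0..s + T} ?f"
    using assms by (intro Henstock_Kurzweil_Integration.integral_combine gain_integrable) auto
  moreover have "integral {s..s + T} ?f = integral {0..T} (\<lambda>t. gain (Y (t + s)) (\<beta> (t + s)))"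
    using integral_shift_cbox[of s s "s + T" ?f] by simp
  ultimately show ?thesis unfolding total_gain_def by simp
qed

definition glue :: "real \<Rightarrow> (real \<Rightarrow> 'x) \<Rightarrow> (real \<Rightarrow> 'x) \<Rightarrow> real \<Rightarrow> 'x" where
  "glue s f g t = (if t < s then f t else g (t - s))"

lemma has_integral_glue:
  fixes f g :: "real \<Rightarrow> 'x::euclidean_space"
  assumes "0 \<le> s" "s \<le> T" "(f has_integral i) {0..s}" "(g has_integral j) {0..T - s}"
    and eq: "\<And>t. \<lbrakk>0 \<le> t; t < s\<rbrakk> \<Longrightarrow> h t = f t" "\<And>t. s \<le> t \<Longrightarrow> h t = g (t - s)"
  shows "(h has_integral (i + j)) {0..T}"
proof (rule has_integral_combine[OF assms(1,2)])
  show "(h has_integral i) {0..s}"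
    by (rule has_integral_spike_finite[OF _ _ assms(3), of "{s}"]) (use eq in auto)
  have "((\<lambda>t. g (t + - s)) has_integral j) {0 - - s..T - s - - s}"
    by (rule has_integral_shift_real_ivl[OF assms(4)])
  then have "((\<lambda>t. g (t - s)) has_integral j) {s..T}" by simp
  then show "(h has_integral j) {s..T}"
    by (rule has_integral_eq[rotated]) (use eq in auto)
qed

lemma integrable_glue:
  fixes f g :: "real \<Rightarrow> 'x::euclidean_space"
  assumes "0 \<le> s" "0 \<le> T" and f: "\<And>T. T \<ge> 0 \<Longrightarrow> f integrable_on {0..T}"
    and g: "\<And>T. T \<ge> 0 \<Longrightarrow> g integrable_on {0..T}"
    and eq: "\<And>t. \<lbrakk>0 \<le> t; t < s\<rbrakk> \<Longrightarrow> h t = f t" "\<And>t. s \<le> t \<Longrightarrow> h t = g (t - s)"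
  shows "h integrable_on {0..T}"
proof (cases "s \<le> T")
  case True
  obtain i j where "(f has_integral i) {0..s}" "(g has_integral j) {0..T - s}"
    using f[of s] g[of "T - s"] assms(1) True by auto
  from has_integral_glue[OF assms(1) True this eq] show ?thesis by blast
next
  case False
  show ?thesis
    by (rule integrable_eq[OF f[OF assms(2)]]) (use eq False in auto)
qed

lemma run_glue:
  assumes "run \<beta> Y" "run \<beta>' Y'" "s \<ge> 0" "Y' 0 = Y s"
  shows "run (glue s \<beta> \<beta>') (glue s Y Y')"
  unfolding run_def
proof (intro allI impI conjI)
  fix T :: real assume T: "T \<ge> 0"
  show "glue s \<beta> \<beta>' integrable_on {0..T}"
    by (rule integrable_glue[of s T \<beta> \<beta>']) (use assms T in \<open>auto simp: glue_def run_def\<close>)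
  show "(\<lambda>t. (norm (glue s \<beta> \<beta>' t))\<^sup>2) integrable_on {0..T}"
    by (rule integrable_glue[of s T "\<lambda>t. (norm (\<beta> t))\<^sup>2" "\<lambda>t. (norm (\<beta>' t))\<^sup>2"])
      (use assms T in \<open>auto simp: glue_def run_def\<close>)
  have Y0: "glue s Y Y' 0 = Y 0" using assms by (auto simp: glue_def)
  show "((\<lambda>t. vel (glue s Y Y' t) (glue s \<beta> \<beta>' t)) has_integral (glue s Y Y' T - glue s Y Y' 0)) {0..T}"
  proof (cases "s \<le> T")
    case True
    have "((\<lambda>t. vel (glue s Y Y' t) (glue s \<beta> \<beta>' t)) has_integral
        ((Y s - Y 0) + (Y' (T - s) - Y' 0))) {0..T}"
      by (rule has_integral_glue[OF assms(3) True, of "\<lambda>t. vel (Y t) (\<beta> t)" _ "\<lambda>t. vel (Y' t) (\<beta>' t)"])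
        (use assms True in \<open>auto simp: glue_def run_def\<close>)
    then show ?thesis using True Y0 assms(4) by (simp add: glue_def)
  next
    case False
    have "((\<lambda>t. vel (Y t) (\<beta> t)) has_integral (Y T - Y 0)) {0..T}"
      using assms(1) T unfolding run_def by blast
    then have "((\<lambda>t. vel (glue s Y Y' t) (glue s \<beta> \<beta>' t)) has_integral (Y T - Y 0)) {0..T}"
      by (rule has_integral_eq[rotated]) (use False in \<open>auto simp: glue_def\<close>)
    then show ?thesis using False Y0 by (simp add: glue_def)
  qed
qed

lemma total_gain_glue:
  assumes "run \<beta> Y" "run \<beta>' Y'" "s \<ge> 0" "T \<ge> 0"
  shows "total_gain (glue s \<beta> \<beta>') (glue s Y Y') (s + T) = total_gain \<beta> Y s + total_gain \<beta>' Y' T"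
  unfolding total_gain_def
  by (rule integral_unique, rule has_integral_glue[OF assms(3), of _ "\<lambda>t. gain (Y t) (\<beta> t)" _ "\<lambda>t. gain (Y' t) (\<beta>' t)"])
    (use assms gain_integrable in \<open>auto simp: glue_def integrable_integral\<close>)

lemma glue_0: "s \<ge> 0 \<Longrightarrow> Y' 0 = Y s \<Longrightarrow> glue s Y Y' 0 = Y 0"
  by (auto simp: glue_def)

lemma run_translate:
  assumes "run \<beta> Y" "\<And>i. k $ i \<in> \<int>"
  shows "run \<beta> (\<lambda>t. Y t + k)" "total_gain \<beta> (\<lambda>t. Y t + k) = total_gain \<beta> Y"
proof -
  have "vel (y + k) e = vel y e" "gain (y + k) e = gain y e" for y e
    using int_periodicD[OF b_periodic assms(2)] int_periodicD[OF \<tau>_periodic assms(2)]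
    by (simp_all add: vel_def gain_def)
  then show "run \<beta> (\<lambda>t. Y t + k)" "total_gain \<beta> (\<lambda>t. Y t + k) = total_gain \<beta> Y"
    using assms(1) unfolding run_def total_gain_def by (simp_all add: fun_eq_iff)
qed

lemma total_gain_le:
  assumes "run \<beta> Y" "T \<ge> 0"
  shows "total_gain \<beta> Y T \<le> b_bound\<^sup>2 * T"
proof -
  have "total_gain \<beta> Y T \<le> integral {0..T} (\<lambda>t. b_bound\<^sup>2)"
    unfolding total_gain_def by (intro integral_le gain_integrable assms) (auto intro: gain_le)
  then show ?thesis using assms(2) by (simp add: mult.commute)
qed

section \<open>Motion along straight lines\<close>

text \<open>
  The symmetric matrix \<open>\<tau>\<tau>\<^sup>T\<close> is positive definite because \<open>\<xi> \<bullet> \<tau>\<tau>\<^sup>T\<xi> = |\<tau>\<^sup>T\<xi>|\<^sup>2\<close>.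
\<close>

lemma gram_solvable: "\<exists>\<xi>. \<tau> y *v (transpose (\<tau> y) *v \<xi>) = u"
proof -
  let ?g = "\<lambda>\<xi>. \<tau> y *v (transpose (\<tau> y) *v \<xi>)"
  have lin: "linear ?g"
    by (rule linearI) (simp_all add: matrix_vector_right_distrib matrix_vector_mult_scaleR)
  have "\<xi> = 0" if "?g \<xi> = 0" for \<xi>
  proof (rule ccontr)
    assume "\<xi> \<noteq> 0"
    then have "0 < (norm (transpose (\<tau> y) *v \<xi>))\<^sup>2"
      using nondegenerate[of \<xi> y] \<theta>_pos by (meson less_trans mult_nonneg_nonneg le_less_trans less_imp_le zero_le_power2)
    also have "\<dots> = \<xi> \<bullet> ?g \<xi>"
      by (simp add: inner_transpose_matrix_vector power2_norm_eq_inner)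
    finally show False using that by simp
  qed
  then have "inj ?g" using lin linear_injective_0 by blast
  then have "surj ?g" using lin linear_injective_imp_surjective by blast
  then show ?thesis by (metis surjD)
qed

definition gram_inverse :: "real ^ 'm \<Rightarrow> real ^ 'm \<Rightarrow> real ^ 'm" where
  "gram_inverse y u = (SOME \<xi>. \<tau> y *v (transpose (\<tau> y) *v \<xi>) = u)"

lemma gram_inverse: "\<tau> y *v (transpose (\<tau> y) *v gram_inverse y u) = u"
  unfolding gram_inverse_def using gram_solvable by (rule someI_ex)

lemma gram_coercive: "\<theta> * norm \<xi> \<le> norm (\<tau> y *v (transpose (\<tau> y) *v \<xi>))"
proof (cases "\<xi> = 0")
  case False
  have "\<theta> * (norm \<xi>)\<^sup>2 \<le> (norm (transpose (\<tau> y) *v \<xi>))\<^sup>2"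
    using nondegenerate[OF False] less_imp_le by blast
  also have "\<dots> = \<xi> \<bullet> (\<tau> y *v (transpose (\<tau> y) *v \<xi>))"
    by (simp add: inner_transpose_matrix_vector power2_norm_eq_inner)
  also have "\<dots> \<le> norm \<xi> * norm (\<tau> y *v (transpose (\<tau> y) *v \<xi>))"
    by (rule norm_cauchy_schwarz)
  finally have "norm \<xi> * (\<theta> * norm \<xi>) \<le> norm \<xi> * norm (\<tau> y *v (transpose (\<tau> y) *v \<xi>))"
    by (simp add: power2_eq_square ac_simps)
  then show ?thesis using False by (simp add: mult_le_cancel_left)
qed (use \<theta>_pos in simp)

lemma norm_gram_inverse_le: "norm (gram_inverse y u) \<le> norm u / \<theta>"
  using gram_coercive[of "gram_inverse y u" y] \<theta>_pos
  by (simp add: gram_inverse pos_le_divide_eq mult.commute)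

lemma gram_inverse_unique:
  "\<tau> y *v (transpose (\<tau> y) *v \<xi>) = u \<Longrightarrow> gram_inverse y u = \<xi>"
proof -
  assume "\<tau> y *v (transpose (\<tau> y) *v \<xi>) = u"
  then have "\<tau> y *v (transpose (\<tau> y) *v (gram_inverse y u - \<xi>)) = 0"
    by (simp add: matrix_vector_mult_diff_distrib gram_inverse)
  then have "\<theta> * norm (gram_inverse y u - \<xi>) \<le> 0"
    using gram_coercive[of "gram_inverse y u - \<xi>" y] by simp
  then show ?thesis using \<theta>_pos by (simp add: mult_le_0_iff)
qed

text \<open>
  By coercivity the distance of the solution at time \<open>s\<close> to the one at time \<open>t\<close> is at most the
  residual of the latter in the system at time \<open>s\<close>, divided by \<open>\<theta>\<close>.  The residual is continuous in
  \<open>s\<close> and vanishes at \<open>s = t\<close>.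
\<close>

lemma gram_inverse_continuous:
  assumes u: "continuous_on S u"  and z: "continuous_on S z"
  shows "continuous_on S (\<lambda>t. gram_inverse (z t) (u t))"
  unfolding continuous_on_def
proof
  fix t assume t: "t \<in> S"
  let ?g = "\<lambda>s. gram_inverse (z s) (u s)"
  let ?h = "\<lambda>s. \<tau> (z s) *v (transpose (\<tau> (z s)) *v ?g t)"
  have bnd: "norm (?g s - ?g t) \<le> norm (u s - ?h s) / \<theta>" for s
  proof -
    have "\<tau> (z s) *v (transpose (\<tau> (z s)) *v (?g s - ?g t)) = u s - ?h s"
      by (simp add: matrix_vector_mult_diff_distrib gram_inverse)
    then show ?thesis
      using gram_coercive[of "?g s - ?g t" "z s"] \<theta>_pos by (simp add: pos_le_divide_eq mult.commute)
  qed
  have "continuous_on S (\<lambda>s. norm (u s - ?h s) / \<theta>)"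
    using continuous_on_compose2[OF \<tau>_continuous z] \<theta>_pos
    by (intro continuous_intros u) auto
  then have "((\<lambda>s. norm (u s - ?h s) / \<theta>) \<longlongrightarrow> norm (u t - ?h t) / \<theta>) (at t within S)"
    using t unfolding continuous_on_def by blast
  then have "((\<lambda>s. norm (u s - ?h s) / \<theta>) \<longlongrightarrow> 0) (at t within S)"
    by (simp add: gram_inverse)
  then have "((\<lambda>s. ?g s - ?g t) \<longlongrightarrow> 0) (at t within S)"
    by (rule Lim_null_comparison[rotated]) (use bnd in auto)
  then show "(?g \<longlongrightarrow> ?g t) (at t within S)"
    using Lim_null by blast
qed

lemma run_line:
  assumes "continuous_on UNIV \<beta>" "\<And>t. vel (y + t *\<^sub>R v) (\<beta> t) = v"
  shows "run \<beta> (\<lambda>t. y + t *\<^sub>R v)"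
  unfolding run_def
proof (intro allI impI conjI)
  fix T :: real assume T: "T \<ge> 0"
  have c: "continuous_on {0..T} \<beta>" using assms(1) continuous_on_subset by blast
  show "\<beta> integrable_on {0..T}" "(\<lambda>t. (norm (\<beta> t))\<^sup>2) integrable_on {0..T}"
    by (intro integrable_continuous_interval continuous_intros c)+
  have "((\<lambda>t. v) has_integral (T - 0) *\<^sub>R v) {0..T}"
    using has_integral_const_real[of v 0 T] T by simp
  then show "((\<lambda>t. vel (y + t *\<^sub>R v) (\<beta> t)) has_integral (y + T *\<^sub>R v - (y + 0 *\<^sub>R v))) {0..T}"
    by (simp add: assms(2))
qed

text \<open>
  The control \<open>b - \<alpha>\<close> with \<open>\<alpha> = \<tau>\<^sup>T\<xi>\<close> and \<open>\<tau>\<tau>\<^sup>T\<xi> = v/2\<close> produces the velocity \<open>v\<close> and has the gain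
  \<open>2 b \<bullet> \<alpha> - |\<alpha>|\<^sup>2\<close>, where \<open>|\<alpha>| \<le> \<tau>_bound |v| / (2\<theta>)\<close>.  The two entries of the maximum bound the
  linear and the quadratic term in \<open>|v|\<close>.
\<close>

definition line_cost where "line_cost = max (b_bound * \<tau>_bound / \<theta>) (\<tau>_bound\<^sup>2 / (4 * \<theta>\<^sup>2))"

lemma line_cost_nonneg: "line_cost \<ge> 0"
  unfolding line_cost_def using b_bound_pos \<tau>_bound_pos \<theta>_pos by (simp add: max_def)

text \<open>
  Straight lines are the only trajectories that are constructed explicitly; all others arise by
  gluing, translation and near optimality, so that no differential equation has to be solved.
\<close>

lemma run_line_cost:
  obtains \<beta> where "run \<beta> (\<lambda>t. y + t *\<^sub>R v)"
    "\<And>T. T \<ge> 0 \<Longrightarrow> total_gain \<beta> (\<lambda>t. y + t *\<^sub>R v) T \<ge> - line_cost * (norm v + (norm v)\<^sup>2) * T"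
proof
  define \<alpha> where "\<alpha> t = transpose (\<tau> (y + t *\<^sub>R v)) *v gram_inverse (y + t *\<^sub>R v) (v /\<^sub>R 2)" for t
  define \<beta> where "\<beta> t = b (y + t *\<^sub>R v) - \<alpha> t" for t
  have z: "continuous_on UNIV (\<lambda>t. y + t *\<^sub>R v)" by (intro continuous_intros)
  have "continuous_on UNIV \<alpha>"
    unfolding \<alpha>_def using continuous_on_compose2[OF \<tau>_continuous z]
    by (intro continuous_intros gram_inverse_continuous z) auto
  then have c: "continuous_on UNIV \<beta>"
    unfolding \<beta>_def using continuous_on_compose2[OF b_continuous z] by (intro continuous_intros) auto
  have "vel (y + t *\<^sub>R v) (\<beta> t) = v" for t
    by (simp add: vel_eq \<beta>_def \<alpha>_def gram_inverse)
  from run_line[OF c this] show r: "run \<beta> (\<lambda>t. y + t *\<^sub>R v)" .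
  fix T :: real assume T: "T \<ge> 0"
  have g: "gain (y + t *\<^sub>R v) (\<beta> t) \<ge> - line_cost * (norm v + (norm v)\<^sup>2)" for t
  proof -
    let ?y = "y + t *\<^sub>R v"
    have "norm (\<alpha> t) \<le> \<tau>_bound * (norm (v /\<^sub>R 2) / \<theta>)"
      unfolding \<alpha>_def using norm_\<tau>_transpose_le norm_gram_inverse_le \<tau>_bound_pos
      by (meson less_imp_le mult_left_mono order_trans)
    then have a: "norm (\<alpha> t) \<le> \<tau>_bound / (2 * \<theta>) * norm v" by simp
    have "(norm (\<alpha> t))\<^sup>2 \<le> (\<tau>_bound / (2 * \<theta>) * norm v)\<^sup>2"
      using a by (rule power_mono) simp
    also have "\<dots> = \<tau>_bound\<^sup>2 / (4 * \<theta>\<^sup>2) * (norm v)\<^sup>2" by (simp add: power_mult_distrib power_divide)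
    also have "\<dots> \<le> line_cost * (norm v)\<^sup>2" unfolding line_cost_def by (intro mult_right_mono) auto
    finally have 1: "(norm (\<alpha> t))\<^sup>2 \<le> line_cost * (norm v)\<^sup>2" .
    have "- (b ?y \<bullet> \<alpha> t) \<le> norm (b ?y) * norm (\<alpha> t)"
      using norm_cauchy_schwarz[of "- b ?y" "\<alpha> t"] by simp
    also have "\<dots> \<le> b_bound * (\<tau>_bound / (2 * \<theta>) * norm v)"
      by (rule mult_mono[OF norm_b_le a]) (use b_bound_pos in simp_all)
    finally have "- (2 * (b ?y \<bullet> \<alpha> t)) \<le> 2 * (b_bound * (\<tau>_bound / (2 * \<theta>) * norm v))" by linarith
    also have "\<dots> = b_bound * \<tau>_bound / \<theta> * norm v" by simp
    also have "\<dots> \<le> line_cost * norm v" unfolding line_cost_def by (intro mult_right_mono) auto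
    finally have 2: "- (2 * (b ?y \<bullet> \<alpha> t)) \<le> line_cost * norm v" .
    have "gain ?y (\<beta> t) = 2 * (b ?y \<bullet> \<alpha> t) - (norm (\<alpha> t))\<^sup>2"
      unfolding gain_def \<beta>_def power2_norm_eq_inner inner_diff_left inner_diff_right
      using inner_commute[of "b ?y" "\<alpha> t"] by linarith
    moreover have "- line_cost * (norm v + (norm v)\<^sup>2) = - (line_cost * norm v) - line_cost * (norm v)\<^sup>2"
      by (simp add: distrib_left)
    ultimately show ?thesis using 1 2 by linarith
  qed
  have "integral {0..T} (\<lambda>t. - line_cost * (norm v + (norm v)\<^sup>2)) \<le> total_gain \<beta> (\<lambda>t. y + t *\<^sub>R v) T"
    unfolding total_gain_def by (intro integral_le gain_integrable[OF r T]) (use g in auto)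
  then show "total_gain \<beta> (\<lambda>t. y + t *\<^sub>R v) T \<ge> - line_cost * (norm v + (norm v)\<^sup>2) * T"
    using T by (simp add: ac_simps)
qed

section \<open>The growth rate of the optimal gain\<close>

text \<open>
  The control \<open>\<beta> = b(y)\<close> has velocity zero and gain zero.
\<close>

lemma run_stationary: "run (\<lambda>_. b y) (\<lambda>_. y)" "total_gain (\<lambda>_. b y) (\<lambda>_. y) T = 0"
proof -
  show "run (\<lambda>_. b y) (\<lambda>_. y)"
    using run_line[of "\<lambda>_. b y" y 0] by (simp add: vel_def)
qed (simp add: total_gain_def gain_def)

definition max_gain :: "real \<Rightarrow> real" where
  "max_gain T = Sup {total_gain \<beta> Y T | \<beta> Y. run \<beta> Y}"

lemma max_gain_bdd: "T \<ge> 0 \<Longrightarrow> bdd_above {total_gain \<beta> Y T | \<beta> Y. run \<beta> Y}"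
  by (rule bdd_aboveI[of _ "b_bound\<^sup>2 * T"]) (auto intro: total_gain_le)

lemma total_gain_le_max_gain: "T \<ge> 0 \<Longrightarrow> run \<beta> Y \<Longrightarrow> total_gain \<beta> Y T \<le> max_gain T"
  unfolding max_gain_def by (rule cSup_upper[OF _ max_gain_bdd]) auto

lemma max_gain_leI: "(\<And>\<beta> Y. run \<beta> Y \<Longrightarrow> total_gain \<beta> Y T \<le> C) \<Longrightarrow> max_gain T \<le> C"
  unfolding max_gain_def by (rule cSup_least) (use run_stationary(1) in blast)+

lemma max_gain_nonneg: "T \<ge> 0 \<Longrightarrow> max_gain T \<ge> 0"
  using total_gain_le_max_gain[OF _ run_stationary(1)] by (simp add: run_stationary)

lemma max_gain_le: "T \<ge> 0 \<Longrightarrow> max_gain T \<le> b_bound\<^sup>2 * T"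
  by (rule max_gain_leI) (rule total_gain_le)

lemma max_gain_approx:
  assumes "T \<ge> 0" "\<epsilon> > 0"
  obtains \<beta> Y where "run \<beta> Y" "total_gain \<beta> Y T \<ge> max_gain T - \<epsilon>"
proof -
  have "\<exists>x\<in>{total_gain \<beta> Y T | \<beta> Y. run \<beta> Y}. max_gain T - \<epsilon> < x"
    unfolding max_gain_def using assms run_stationary(1)
    by (intro less_cSup_iff[THEN iffD1] max_gain_bdd) auto
  then show ?thesis using that by force
qed

lemma max_gain_subadditive:
  assumes "S \<ge> 0" "T \<ge> 0"
  shows "max_gain (S + T) \<le> max_gain S + max_gain T"
proof (rule max_gain_leI)
  fix \<beta> Y assume r: "run \<beta> Y"
  have "total_gain \<beta> Y (S + T) = total_gain \<beta> Y S + total_gain (\<lambda>t. \<beta> (t + S)) (\<lambda>t. Y (t + S)) T"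
    using total_gain_shift[OF r assms] by simp
  also have "\<dots> \<le> max_gain S + max_gain T"
    using assms r by (intro add_mono total_gain_le_max_gain run_shift)
  finally show "total_gain \<beta> Y (S + T) \<le> max_gain S + max_gain T" .
qed

definition cube_diam :: real where "cube_diam = norm (1 :: real ^ 'm)"

text \<open>
  This is the cost of a segment of length at most \<open>cube_diam\<close> covered in unit time.
\<close>

definition link_cost :: real where "link_cost = line_cost * (cube_diam + cube_diam\<^sup>2)"

lemma link_cost_nonneg: "link_cost \<ge> 0"
  unfolding link_cost_def cube_diam_def using line_cost_nonneg by simp

text \<open>
  By periodicity the starting point of \<open>Y\<close> matters only modulo \<open>\<int>\<^sup>m\<close>, so a segment no longer
  than the diameter of the unit cube leads to it from any prescribed \<open>y\<close>.
\<close>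

lemma run_prepend:
  assumes "run \<beta> Y"
  obtains \<beta>' Y' where "run \<beta>' Y'" "Y' 0 = y"
    "\<And>T. T \<ge> 0 \<Longrightarrow> total_gain \<beta>' Y' (1 + T) \<ge> - link_cost + total_gain \<beta> Y T"
proof -
  obtain k0 where k0: "\<And>i. k0 $ i \<in> \<int>" "y + k0 \<in> unit_cube" using cube_translate by blast
  obtain k1 where k1: "\<And>i. k1 $ i \<in> \<int>" "Y 0 + k1 \<in> unit_cube" using cube_translate by blast
  define k where "k = k1 - k0"
  have k: "k $ i \<in> \<int>" for i using k0(1) k1(1) by (simp add: k_def)
  \<comment> \<open>The segment leads in unit time from y to the translate of Y 0 whose difference to y
     is that of two points of the unit cube.\<close>
  define v where "v = Y 0 + k - y"
  have "norm v \<le> cube_diam"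
    unfolding cube_diam_def
  proof (rule norm_le_componentwise_cart)
    fix i
    have "v $ i = (Y 0 + k1) $ i - (y + k0) $ i" by (simp add: v_def k_def)
    moreover have "0 \<le> (Y 0 + k1) $ i" "(Y 0 + k1) $ i \<le> 1" "0 \<le> (y + k0) $ i" "(y + k0) $ i \<le> 1"
      using k0(2) k1(2) unfolding mem_box_cart by (auto dest!: spec[of _ i])
    ultimately show "norm (v $ i) \<le> norm ((1 :: real ^ 'm) $ i)" by simp
  qed
  then have "norm v + (norm v)\<^sup>2 \<le> cube_diam + cube_diam\<^sup>2" by (intro add_mono power_mono) auto
  then have cost: "line_cost * (norm v + (norm v)\<^sup>2) \<le> link_cost"
    unfolding link_cost_def using line_cost_nonneg by (rule mult_left_mono)
  obtain \<gamma> where g: "run \<gamma> (\<lambda>t. y + t *\<^sub>R v)"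
    "\<And>T. T \<ge> 0 \<Longrightarrow> total_gain \<gamma> (\<lambda>t. y + t *\<^sub>R v) T \<ge> - line_cost * (norm v + (norm v)\<^sup>2) * T"
    using run_line_cost by blast
  let ?Z = "\<lambda>t. Y t + k"
  have Z: "run \<beta> ?Z" "total_gain \<beta> ?Z = total_gain \<beta> Y" using run_translate[OF assms k] by auto
  have m: "?Z 0 = y + 1 *\<^sub>R v" by (simp add: v_def)
  show ?thesis
  proof
    show "run (glue 1 \<gamma> \<beta>) (glue 1 (\<lambda>t. y + t *\<^sub>R v) ?Z)"
      using run_glue[OF g(1) Z(1) _ m] by simp
    show "glue 1 (\<lambda>t. y + t *\<^sub>R v) ?Z 0 = y" by (simp add: glue_def)
    fix T :: real assume T: "T \<ge> 0"
    show "total_gain (glue 1 \<gamma> \<beta>) (glue 1 (\<lambda>t. y + t *\<^sub>R v) ?Z) (1 + T) \<ge> - link_cost + total_gain \<beta> Y T"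
      using total_gain_glue[OF g(1) Z(1) _ T, of 1] g(2)[of 1] cost Z(2) by simp
  qed
qed

lemma max_gain_superadditive:
  assumes "S \<ge> 0" "T \<ge> 0"
  shows "max_gain S + max_gain T - link_cost \<le> max_gain (S + T + 1)"
proof (rule field_le_epsilon)
  fix \<epsilon> :: real assume e: "\<epsilon> > 0"
  obtain \<beta> Y where 1: "run \<beta> Y" "total_gain \<beta> Y S \<ge> max_gain S - \<epsilon> / 2"
    using max_gain_approx[OF assms(1), of "\<epsilon> / 2"] e by auto
  obtain \<beta>' Y' where 2: "run \<beta>' Y'" "total_gain \<beta>' Y' T \<ge> max_gain T - \<epsilon> / 2"
    using max_gain_approx[OF assms(2), of "\<epsilon> / 2"] e by auto
  obtain \<gamma> Z where 3: "run \<gamma> Z" "Z 0 = Y S"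
    "\<And>T. T \<ge> 0 \<Longrightarrow> total_gain \<gamma> Z (1 + T) \<ge> - link_cost + total_gain \<beta>' Y' T"
    using run_prepend[OF 2(1)] by blast
  have "total_gain (glue S \<beta> \<gamma>) (glue S Y Z) (S + (1 + T)) \<le> max_gain (S + (1 + T))"
    using assms run_glue[OF 1(1) 3(1) assms(1) 3(2)] by (intro total_gain_le_max_gain) auto
  then show "max_gain S + max_gain T - link_cost \<le> max_gain (S + T + 1) + \<epsilon>"
    using total_gain_glue[OF 1(1) 3(1) assms(1), of "1 + T"] assms 1(2) 2(2) 3(3)[OF assms(2)]
    by (simp add: ac_simps)
qed

definition crit :: real where "crit = (INF T\<in>{0<..}. max_gain T / T)"

lemma crit_le:
  assumes "T > 0"
  shows "crit \<le> max_gain T / T"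
  unfolding crit_def
proof (rule cINF_lower)
  show "bdd_below ((\<lambda>T. max_gain T / T) ` {0<..})"
    by (rule bdd_belowI2[of _ 0]) (simp add: max_gain_nonneg)
qed (use assms in simp)

lemma crit_nonneg: "crit \<ge> 0"
  unfolding crit_def by (rule cINF_greatest) (auto simp: max_gain_nonneg)

lemma crit_mult_le: "T \<ge> 0 \<Longrightarrow> crit * T \<le> max_gain T"
  using crit_le[of T] max_gain_nonneg[of 0] by (cases "T = 0") (auto simp: pos_le_divide_eq)

text \<open>
  Superadditivity, applied \<open>k\<close> times, bounds \<open>k (max_gain T - link_cost)\<close> by the largest gain up
  to time \<open>k (T + 1)\<close>; cutting this time into blocks of length \<open>S\<close>, subadditivity bounds it by
  \<open>k (T + 1) max_gain S / S\<close> plus a constant.  Dividing by \<open>k\<close>, letting \<open>k\<close> grow and minimizing over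
  \<open>S\<close> gives the claim.
\<close>

lemma max_gain_le_crit:
  assumes "T \<ge> 0"
  shows "max_gain T \<le> crit * (T + 1) + link_cost"
proof -
  have mult: "real k * (max_gain T - link_cost) \<le> max_gain (real k * (T + 1))" for k
  proof (induction k)
    case 0 then show ?case using max_gain_nonneg[of 0] by simp
  next
    case (Suc k)
    have "real (Suc k) * (max_gain T - link_cost) \<le> max_gain (real k * (T + 1)) + max_gain T - link_cost"
      using Suc by (simp add: algebra_simps)
    also have "\<dots> \<le> max_gain (real k * (T + 1) + T + 1)"
      using assms by (intro max_gain_superadditive) auto
    finally show ?case by (simp add: algebra_simps)
  qed
  have "(max_gain T - link_cost) / (T + 1) \<le> max_gain S / S" if S: "S > 0" for S
  proof -
    have jS: "max_gain (real j * S + r) \<le> real j * max_gain S + b_bound\<^sup>2 * r" if "r \<ge> 0" for j r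
    proof (induction j)
      case 0 then show ?case using max_gain_le[OF that] by simp
    next
      case (Suc j)
      have "max_gain (real (Suc j) * S + r) = max_gain (S + (real j * S + r))"
        by (simp add: algebra_simps)
      also have "\<dots> \<le> max_gain S + max_gain (real j * S + r)"
        using that S by (intro max_gain_subadditive) auto
      finally show ?case using Suc by (simp add: algebra_simps)
    qed
    have up: "max_gain X \<le> X / S * max_gain S + b_bound\<^sup>2 * S" if X: "X \<ge> 0" for X
    proof -
      define j where "j = nat \<lfloor>X / S\<rfloor>"
      have j: "real j \<le> X / S" "X / S < real j + 1"
        using X S by (auto simp: j_def)
      then have r: "0 \<le> X - real j * S" "X - real j * S \<le> S"
        using S by (auto simp: field_simps)
      have "max_gain X \<le> real j * max_gain S + b_bound\<^sup>2 * (X - real j * S)"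
        using jS[OF r(1), of j] by simp
      also have "\<dots> \<le> X / S * max_gain S + b_bound\<^sup>2 * S"
        using j r max_gain_nonneg[of S] S by (intro add_mono mult_right_mono mult_left_mono) auto
      finally show ?thesis .
    qed
    define x where "x = max_gain T - link_cost - (T + 1) / S * max_gain S"
    have "real k * x \<le> b_bound\<^sup>2 * S" for k
    proof -
      have "real k * (max_gain T - link_cost) \<le> real k * (T + 1) / S * max_gain S + b_bound\<^sup>2 * S"
        using mult[of k] up[of "real k * (T + 1)"] assms by simp
      then show ?thesis by (simp add: x_def algebra_simps)
    qed
    then have "x \<le> 0"
      using reals_Archimedean3[of x] by (meson not_less)
    then show ?thesis
      using assms S by (simp add: x_def field_simps)
  qed
  then have "(max_gain T - link_cost) / (T + 1) \<le> crit"
    unfolding crit_def by (intro cINF_greatest) auto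
  then show ?thesis using assms by (simp add: field_simps)
qed

definition excess_bound :: real where "excess_bound = crit + link_cost"

lemma excess_bound_nonneg: "excess_bound \<ge> 0"
  by (simp add: excess_bound_def crit_nonneg link_cost_nonneg)

lemma excess_le:
  assumes "run \<beta> Y" "T \<ge> 0"
  shows "total_gain \<beta> Y T - crit * T \<le> excess_bound"
  using total_gain_le_max_gain[OF assms(2,1)] max_gain_le_crit[OF assms(2)]
  by (simp add: excess_bound_def algebra_simps)

text \<open>
  The part of a run after time \<open>s\<close> is again a run.
\<close>

lemma excess_increment_le:
  assumes "run \<beta> Y" "0 \<le> s" "s \<le> T"
  shows "(total_gain \<beta> Y T - crit * T) - (total_gain \<beta> Y s - crit * s) \<le> excess_bound"
proof -
  have "total_gain (\<lambda>t. \<beta> (t + s)) (\<lambda>t. Y (t + s)) (T - s) - crit * (T - s) \<le> excess_bound"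
    using assms by (intro excess_le run_shift) auto
  then show ?thesis
    using total_gain_shift[OF assms(1,2), of "T - s"] assms(3) by (simp add: algebra_simps)
qed

text \<open>
  A run that is nearly optimal for \<open>max_gain T \<ge> crit * T\<close> can start anywhere, so a link of unit
  length is put in front of it; the last unit of time, which is now too much, contributes at most
  \<open>excess_bound\<close> and can be dropped.
\<close>

lemma excess_ge:
  assumes "T \<ge> 0"
  obtains \<beta> Y where "run \<beta> Y" "Y 0 = y" "total_gain \<beta> Y T - crit * T \<ge> - (2 * excess_bound + 1)"
proof -
  obtain \<beta> Y where 1: "run \<beta> Y" "total_gain \<beta> Y T \<ge> max_gain T - 1"
    using max_gain_approx[OF assms, of 1] by auto
  obtain \<gamma> Z where 3: "run \<gamma> Z" "Z 0 = y"
    "\<And>T. T \<ge> 0 \<Longrightarrow> total_gain \<gamma> Z (1 + T) \<ge> - link_cost + total_gain \<beta> Y T"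
    using run_prepend[OF 1(1)] by blast
  have "total_gain \<gamma> Z T - crit * T \<ge> - (2 * excess_bound + 1)"
    using excess_increment_le[OF 3(1) assms, of "1 + T"] 3(3)[OF assms] 1(2) crit_mult_le[OF assms]
    by (simp add: excess_bound_def algebra_simps)
  with 3(1,2) that show ?thesis by blast
qed

section \<open>The corrector\<close>

definition excesses :: "real \<Rightarrow> real ^ 'm \<Rightarrow> real set" where
  "excesses T y = {total_gain \<beta> Y t - crit * t | \<beta> Y t. run \<beta> Y \<and> Y 0 = y \<and> t \<ge> T}"

text \<open>
  The horizon \<open>t\<close> is free above \<open>T\<close>.  This makes \<open>tail_value T\<close> decreasing in \<open>T\<close> without spoiling
  dynamic programming, in which a waiting time \<open>s\<close> only shifts \<open>T\<close> to \<open>s + T\<close>.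
\<close>

definition tail_value :: "real \<Rightarrow> real ^ 'm \<Rightarrow> real" where
  "tail_value T y = Sup (excesses T y)"

lemma excesses_bdd: "T \<ge> 0 \<Longrightarrow> bdd_above (excesses T y)"
  by (rule bdd_aboveI[of _ excess_bound]) (auto simp: excesses_def intro: excess_le)

lemma excesses_nonempty: "excesses T y \<noteq> {}"
  unfolding excesses_def using run_stationary(1)[of y] by fastforce

lemma excess_le_tail_value:
  "\<lbrakk>run \<beta> Y; 0 \<le> T; T \<le> t\<rbrakk> \<Longrightarrow> total_gain \<beta> Y t - crit * t \<le> tail_value T (Y 0)"
  unfolding tail_value_def by (rule cSup_upper[OF _ excesses_bdd]) (auto simp: excesses_def)

lemma tail_value_approx:
  assumes "T \<ge> 0" "\<epsilon> > 0"
  obtains \<beta> Y t where "run \<beta> Y" "Y 0 = y" "T \<le> t" "tail_value T y - \<epsilon> < total_gain \<beta> Y t - crit * t"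
proof -
  have "\<exists>x\<in>excesses T y. tail_value T y - \<epsilon> < x"
    unfolding tail_value_def using assms
    by (intro less_cSup_iff[THEN iffD1] excesses_bdd excesses_nonempty) auto
  then show ?thesis using that unfolding excesses_def by auto
qed

lemma tail_value_ge: "T \<ge> 0 \<Longrightarrow> tail_value T y \<ge> - (2 * excess_bound + 1)"
  using excess_ge[of T y] excess_le_tail_value[of _ _ T T] by (metis order_refl order_trans)

lemma tail_value_antimono:
  assumes "0 \<le> S" "S \<le> T"
  shows "tail_value T y \<le> tail_value S y"
  unfolding tail_value_def
  by (rule cSup_subset_mono[OF excesses_nonempty excesses_bdd[OF assms(1)]])
    (use assms(2) in \<open>fastforce simp: excesses_def\<close>)

text \<open>
  Following a given run up to time \<open>s\<close> and then a nearly optimal one is one of the competitors.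
\<close>

lemma tail_value_ge_run:
  assumes "run \<beta> Y" "s \<ge> 0" "T \<ge> 0"
  shows "total_gain \<beta> Y s - crit * s + tail_value T (Y s) \<le> tail_value (s + T) (Y 0)"
proof (rule field_le_epsilon)
  fix \<epsilon> :: real assume "\<epsilon> > 0"
  then obtain \<beta>' Y' t where 1: "run \<beta>' Y'" "Y' 0 = Y s" "T \<le> t"
      "tail_value T (Y s) - \<epsilon> < total_gain \<beta>' Y' t - crit * t"
    using tail_value_approx[OF assms(3)] by metis
  have "total_gain (glue s \<beta> \<beta>') (glue s Y Y') (s + t) - crit * (s + t)
      \<le> tail_value (s + T) (glue s Y Y' 0)"
    using assms 1 by (intro excess_le_tail_value run_glue) auto
  then show "total_gain \<beta> Y s - crit * s + tail_value T (Y s) \<le> tail_value (s + T) (Y 0) + \<epsilon>"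
    using total_gain_glue[OF assms(1) 1(1) assms(2), of t] 1 assms
      glue_0[where s = s and Y = Y and Y' = Y'] by (simp add: distrib_left)
qed

text \<open>
  A nearly optimal run from \<open>y\<close> is, after time \<open>s\<close>, a competitor from the point \<open>Y s\<close>.
\<close>

lemma tail_value_le_run:
  assumes "s \<ge> 0" "T \<ge> 0" "\<epsilon> > 0"
  obtains \<beta> Y where "run \<beta> Y" "Y 0 = y"
    "tail_value (s + T) y \<le> total_gain \<beta> Y s - crit * s + tail_value T (Y s) + \<epsilon>"
proof -
  obtain \<beta> Y t where 1: "run \<beta> Y" "Y 0 = y" "s + T \<le> t"
      "tail_value (s + T) y - \<epsilon> < total_gain \<beta> Y t - crit * t"
    using tail_value_approx[of "s + T" \<epsilon> y] assms by auto
  have "total_gain (\<lambda>t. \<beta> (t + s)) (\<lambda>t. Y (t + s)) (t - s) - crit * (t - s) \<le> tail_value T (Y (0 + s))"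
    using assms 1(3) by (intro excess_le_tail_value[of _ "\<lambda>t. Y (t + s)"] run_shift[OF 1(1)]) auto
  then have "tail_value (s + T) y \<le> total_gain \<beta> Y s - crit * s + tail_value T (Y s) + \<epsilon>"
    using total_gain_shift[OF 1(1) assms(1), of "t - s"] 1(3,4) assms
    by (simp add: right_diff_distrib)
  with 1 that show ?thesis by blast
qed

lemma tail_value_periodic: "int_periodic (tail_value T)"
  unfolding int_periodic_def
proof (intro allI impI)
  fix y k :: "real ^ 'm" assume k: "\<forall>i. k $ i \<in> \<int>"
  have sub: "excesses T y \<subseteq> excesses T (y + k)" if "\<And>i. k $ i \<in> \<int>" for y k
  proof
    fix x assume "x \<in> excesses T y"
    then obtain \<beta> Y t where *: "x = total_gain \<beta> Y t - crit * t" "run \<beta> Y" "Y 0 = y" "T \<le> t"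
      unfolding excesses_def by blast
    show "x \<in> excesses T (y + k)"
      unfolding excesses_def mem_Collect_eq
      by (intro exI[of _ \<beta>] exI[of _ "\<lambda>t. Y t + k"] exI[of _ t] conjI)
        (use * run_translate[OF *(2) that] in auto)
  qed
  have "excesses T (y + k) \<subseteq> excesses T (y + k + - k)"
    by (rule sub) (use k in auto)
  with sub[of k y] k have "excesses T (y + k) = excesses T y" by auto
  then show "tail_value T (y + k) = tail_value T y" by (simp add: tail_value_def)
qed

definition corrector_lip :: real where "corrector_lip = 2 * line_cost + crit"

lemma corrector_lip_nonneg: "corrector_lip \<ge> 0" by (simp add: corrector_lip_def line_cost_nonneg crit_nonneg)

text \<open>
  Walk from \<open>y\<close> to \<open>z\<close> at unit speed.  This takes the time \<open>dist y z\<close>, and the increase of \<open>T\<close> by this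
  amount is harmless since tail values decrease in \<open>T\<close>.
\<close>

lemma tail_value_lipschitz_le:
  assumes "T \<ge> 0"
  shows "tail_value T z \<le> tail_value T y + corrector_lip * dist y z"
proof (cases "y = z")
  case False
  define d where "d = dist y z"
  have d: "d > 0" using False by (simp add: d_def)
  define v where "v = (z - y) /\<^sub>R d"
  have v: "norm v = 1" "y + d *\<^sub>R v = z"
    using d by (simp_all add: v_def d_def dist_norm norm_minus_commute)
  obtain \<gamma> where g: "run \<gamma> (\<lambda>t. y + t *\<^sub>R v)"
    "\<And>T. T \<ge> 0 \<Longrightarrow> total_gain \<gamma> (\<lambda>t. y + t *\<^sub>R v) T \<ge> - line_cost * (norm v + (norm v)\<^sup>2) * T"
    using run_line_cost by blast
  have "tail_value (d + T) y \<le> tail_value T y" using assms d by (intro tail_value_antimono) auto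
  then show ?thesis
    using tail_value_ge_run[OF g(1) _ assms, of d] g(2)[of d] d v
    by (simp add: corrector_lip_def algebra_simps flip: d_def)
qed simp

definition corrector :: "real ^ 'm \<Rightarrow> real" where
  "corrector y = (INF T\<in>{0..}. tail_value T y)"

lemma corrector_le: "T \<ge> 0 \<Longrightarrow> corrector y \<le> tail_value T y"
  unfolding corrector_def
  by (rule cINF_lower) (auto intro: bdd_belowI2[of _ "- (2 * excess_bound + 1)"] tail_value_ge)

lemma corrector_geI: "(\<And>T. T \<ge> 0 \<Longrightarrow> C \<le> tail_value T y) \<Longrightarrow> C \<le> corrector y"
  unfolding corrector_def by (rule cINF_greatest) auto

lemma corrector_approx:
  assumes "\<epsilon> > 0"
  obtains T where "T \<ge> 0" "tail_value T y < corrector y + \<epsilon>"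
proof -
  have "\<not> (\<forall>T\<ge>0. corrector y + \<epsilon> \<le> tail_value T y)"
    using corrector_geI[of "corrector y + \<epsilon>" y] assms by fastforce
  then show ?thesis using that by (auto simp: not_le)
qed

lemma corrector_periodic: "int_periodic corrector"
  using tail_value_periodic unfolding int_periodic_def corrector_def by simp

lemma corrector_lipschitz_le: "corrector z \<le> corrector y + corrector_lip * dist y z"
proof -
  have "corrector z - corrector_lip * dist y z \<le> corrector y"
  proof (rule corrector_geI)
    fix T :: real assume "T \<ge> 0"
    then show "corrector z - corrector_lip * dist y z \<le> tail_value T y"
      using corrector_le[of T z] tail_value_lipschitz_le[of T z y] by simp
  qed
  then show ?thesis by simp
qed

lemma corrector_continuous: "continuous_on UNIV corrector"
proof (rule lipschitz_on_continuous_on)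
  show "corrector_lip-lipschitz_on UNIV corrector"
  proof (rule lipschitz_onI)
    fix y z :: "real ^ 'm"
    show "dist (corrector y) (corrector z) \<le> corrector_lip * dist y z"
      using corrector_lipschitz_le[of y z] corrector_lipschitz_le[of z y]
      by (simp add: dist_real_def abs_le_iff dist_commute)
  qed (rule corrector_lip_nonneg)
qed

text \<open>
  This is Dini's argument: pointwise convergence on a finite net of the unit cube suffices because
  all tail values and their infimum share a Lipschitz constant.
\<close>

lemma tail_value_uniform:
  assumes "\<epsilon> > 0"
  obtains T where "T \<ge> 0" "\<And>y. tail_value T y \<le> corrector y + \<epsilon>"
proof -
  \<comment> \<open>Moving to a nearby point of the net and back costs a quarter of \<open>\<epsilon>\<close> each way.\<close>
  define r where "r = \<epsilon> / (4 * (corrector_lip + 1))"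
  have r: "r > 0" "corrector_lip * r \<le> \<epsilon> / 4"
    using assms corrector_lip_nonneg by (auto simp: r_def field_simps add_pos_nonneg intro!: divide_pos_pos)
  have "\<forall>y. \<exists>T\<ge>0. tail_value T y < corrector y + \<epsilon> / 2"
    using corrector_approx[of "\<epsilon> / 2"] assms by (metis half_gt_zero)
  then obtain \<T> where T: "\<And>y. \<T> y \<ge> 0" "\<And>y. tail_value (\<T> y) y < corrector y + \<epsilon> / 2"
    by metis
  obtain N where N: "finite N" "(unit_cube :: (real ^ 'm) set) \<subseteq> (\<Union>z\<in>N. ball z r)"
  proof (rule compactE_image[of "unit_cube :: (real ^ 'm) set" UNIV "\<lambda>z. ball z r"])
    show "(unit_cube :: (real ^ 'm) set) \<subseteq> (\<Union>z\<in>UNIV. ball z r)" using r(1) centre_in_ball by blast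
  qed auto
  define S where "S = Max (insert 0 (\<T> ` N))"
  have S: "S \<ge> 0" "\<And>z. z \<in> N \<Longrightarrow> \<T> z \<le> S" using N(1) by (auto simp: S_def)
  show ?thesis
  proof
    fix y :: "real ^ 'm"
    obtain k where k: "\<And>i. k $ i \<in> \<int>" "y + k \<in> unit_cube" using cube_translate by blast
    obtain z where z: "z \<in> N" "dist z (y + k) < r" using N(2) k(2) by auto
    have "corrector_lip * dist z (y + k) \<le> corrector_lip * r" using z(2) corrector_lip_nonneg by (intro mult_left_mono) auto
    then have *: "corrector_lip * dist z (y + k) \<le> \<epsilon> / 4" "corrector_lip * dist (y + k) z \<le> \<epsilon> / 4"
      using r(2) by (auto simp: dist_commute)
    have "tail_value S (y + k) \<le> tail_value S z + \<epsilon> / 4"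
      using tail_value_lipschitz_le[OF S(1), of "y + k" z] * by simp
    also have "tail_value S z \<le> tail_value (\<T> z) z" using S z(1) T(1) by (intro tail_value_antimono) auto
    also have "tail_value (\<T> z) z \<le> corrector z + \<epsilon> / 2" using T(2) less_imp_le by blast
    also have "corrector z \<le> corrector (y + k) + \<epsilon> / 4"
      using corrector_lipschitz_le[of z "y + k"] * by simp
    finally show "tail_value S y \<le> corrector y + \<epsilon>"
      using int_periodicD[OF tail_value_periodic k(1)] int_periodicD[OF corrector_periodic k(1)] by simp
  qed (rule S)
qed

lemma corrector_ge_run:
  assumes "run \<beta> Y" "s \<ge> 0"
  shows "total_gain \<beta> Y s - crit * s + corrector (Y s) \<le> corrector (Y 0)"
proof (rule corrector_geI)
  fix T :: real assume T: "T \<ge> 0"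
  have "total_gain \<beta> Y s - crit * s + corrector (Y s) \<le> total_gain \<beta> Y s - crit * s + tail_value T (Y s)"
    using corrector_le[OF T] by simp
  also have "\<dots> \<le> tail_value (s + T) (Y 0)" by (rule tail_value_ge_run[OF assms T])
  also have "\<dots> \<le> tail_value T (Y 0)" using T assms by (intro tail_value_antimono) auto
  finally show "total_gain \<beta> Y s - crit * s + corrector (Y s) \<le> tail_value T (Y 0)" .
qed

text \<open>
  The end point \<open>Y s\<close> depends on \<open>T\<close>, so replacing \<open>tail_value T (Y s)\<close> by the limit requires
  uniform convergence.
\<close>

lemma corrector_le_run:
  assumes "s \<ge> 0" "\<epsilon> > 0"
  obtains \<beta> Y where "run \<beta> Y" "Y 0 = y"
    "corrector y \<le> total_gain \<beta> Y s - crit * s + corrector (Y s) + \<epsilon>"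
proof -
  obtain T where T: "T \<ge> 0" "\<And>y. tail_value T y \<le> corrector y + \<epsilon> / 2"
    using tail_value_uniform[of "\<epsilon> / 2"] assms by auto
  obtain \<beta> Y where r: "run \<beta> Y" "Y 0 = y"
      "tail_value (s + T) y \<le> total_gain \<beta> Y s - crit * s + tail_value T (Y s) + \<epsilon> / 2"
    using tail_value_le_run[OF assms(1) T(1), of "\<epsilon> / 2" y] assms(2) by auto
  have "corrector y \<le> tail_value (s + T) y" using assms T by (intro corrector_le) auto
  then have "corrector y \<le> total_gain \<beta> Y s - crit * s + corrector (Y s) + \<epsilon>"
    using r(3) T(2)[of "Y s"] by linarith
  with r(1,2) that show ?thesis by blast
qed

section \<open>Comparison\<close>

abbreviation cell_op :: "real \<Rightarrow> real ^ 'm \<Rightarrow> real ^ 'm \<Rightarrow> real" where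
  "cell_op H y q \<equiv> H - ham y q"

lemma norm_ham_vector_le: "norm (transpose (\<tau> y) *v q + b y) \<le> \<tau>_bound * norm q + b_bound"
  using norm_triangle_ineq[of "transpose (\<tau> y) *v q" "b y"] norm_\<tau>_transpose_le[of y q] norm_b_le[of y]
  by linarith

text \<open>
  Nondegeneracy gives \<open>sqrt \<theta> * |q| \<le> |\<tau>\<^sup>T q|\<close>.
\<close>

lemma ham_coercive:
  assumes "ham y q \<le> H"
  shows "sqrt \<theta> * norm q \<le> sqrt H + b_bound"
proof -
  have "sqrt \<theta> * norm q \<le> norm (transpose (\<tau> y) *v q)"
  proof (cases "q = 0")
    case False
    have "sqrt (\<theta> * (norm q)\<^sup>2) \<le> sqrt ((norm (transpose (\<tau> y) *v q))\<^sup>2)"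
      using nondegenerate[OF False, of y] by (simp del: real_sqrt_abs)
    then show ?thesis by (simp add: real_sqrt_mult)
  qed simp
  also have "\<dots> \<le> norm (transpose (\<tau> y) *v q + b y) + norm (b y)"
    using norm_triangle_ineq4[of "transpose (\<tau> y) *v q + b y" "b y"] by simp
  also have "norm (transpose (\<tau> y) *v q + b y) \<le> sqrt H"
    using assms unfolding ham_def by (simp add: real_le_rsqrt)
  also have "norm (b y) \<le> b_bound" by (rule norm_b_le)
  finally show ?thesis by simp
qed

text \<open>
  The Hamiltonian is a square, and on bounded sets of \<open>q\<close> the vector \<open>\<tau>\<^sup>T q + b\<close> is bounded and
  uniformly continuous in \<open>y\<close>.
\<close>

lemma ham_uniformly_continuous:
  assumes "\<epsilon> > 0" "R \<ge> 0"
  obtains d where "d > 0"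
    "\<And>x y q. \<lbrakk>dist x y < d; norm q \<le> R\<rbrakk> \<Longrightarrow> ham x q \<le> ham y q + \<epsilon>"
proof -
  define M where "M = \<tau>_bound * R + b_bound"
  have M: "M > 0" using \<tau>_bound_pos b_bound_pos assms by (simp add: M_def add_nonneg_pos)
  define \<eta> where "\<eta> = \<epsilon> / (2 * M)"
  have \<eta>: "\<eta> > 0" using assms M by (simp add: \<eta>_def)
  obtain D where D: "D > 0" "\<And>(A :: real ^ 'm ^ 'r) x. norm (A *v x) \<le> norm A * norm x * D"
    using bounded_bilinear.pos_bounded[OF bounded_bilinear_matrix_vector_mult] by blast
  have tp: "int_periodic (\<lambda>y. transpose (\<tau> y))" "continuous_on UNIV (\<lambda>y. transpose (\<tau> y))"
    using \<tau>_periodic by (auto simp: int_periodic_def intro: continuous_intros \<tau>_continuous)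
  have "\<eta> / (2 * D * (R + 1)) > 0" using \<eta> D assms by simp
  then obtain d1 where d1: "d1 > 0"
    "\<And>x y. dist x y < d1 \<Longrightarrow> dist (transpose (\<tau> x)) (transpose (\<tau> y)) < \<eta> / (2 * D * (R + 1))"
    using int_periodic_uniformly_continuous[OF tp] by metis
  obtain d2 where d2: "d2 > 0" "\<And>x y. dist x y < d2 \<Longrightarrow> dist (b x) (b y) < \<eta> / 2"
    using int_periodic_uniformly_continuous[OF b_periodic b_continuous, of "\<eta> / 2"] \<eta>
    by (metis half_gt_zero)
  show ?thesis
  proof
    show "min d1 d2 > 0" using d1 d2 by simp
    fix x y q :: "real ^ 'm" assume xy: "dist x y < min d1 d2" and q: "norm q \<le> R"
    let ?u = "\<lambda>x. transpose (\<tau> x) *v q + b x"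
    have "norm (transpose (\<tau> x) *v q - transpose (\<tau> y) *v q) \<le> norm (transpose (\<tau> x) - transpose (\<tau> y)) * norm q * D"
      using D(2)[of "transpose (\<tau> x) - transpose (\<tau> y)" q] by (simp add: matrix_vector_mult_diff_rdistrib)
    also have "\<dots> \<le> \<eta> / (2 * D * (R + 1)) * (R + 1) * D"
      using d1(2)[of x y] xy q D(1) assms(2) \<eta>
      by (intro mult_right_mono mult_mono) (auto simp: dist_norm)
    also have "\<dots> = \<eta> / 2"
    proof -
      have "\<eta> / (2 * D * S) * S * D = \<eta> / 2" if "S \<noteq> 0" for S using that D(1) by simp
      from this[of "R + 1"] show ?thesis using assms(2) by linarith
    qed
    finally have "norm (transpose (\<tau> x) *v q - transpose (\<tau> y) *v q) \<le> \<eta> / 2" .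
    moreover have "norm (b x - b y) \<le> \<eta> / 2" using d2(2)[of x y] xy by (simp add: dist_norm)
    moreover have uu_eq: "?u x - ?u y = (transpose (\<tau> x) *v q - transpose (\<tau> y) *v q) + (b x - b y)" by simp
    ultimately have uu: "norm (?u x - ?u y) \<le> \<eta>"
      unfolding uu_eq
      using norm_triangle_ineq[of "transpose (\<tau> x) *v q - transpose (\<tau> y) *v q" "b x - b y"] by linarith
    have "\<tau>_bound * norm q \<le> \<tau>_bound * R" using q \<tau>_bound_pos by simp
    then have le: "norm (?u z) \<le> M" for z
      using norm_ham_vector_le[of z q] by (simp add: M_def)
    have "ham x q - ham y q = (norm (?u x) - norm (?u y)) * (norm (?u x) + norm (?u y))"
      by (simp add: ham_def power2_eq_square algebra_simps)
    also have "\<dots> \<le> \<eta> * (2 * M)"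
    proof (rule mult_mono)
      show "norm (?u x) - norm (?u y) \<le> \<eta>" using uu norm_triangle_ineq2[of "?u x" "?u y"] by linarith
      show "norm (?u x) + norm (?u y) \<le> 2 * M" using le[of x] le[of y] by linarith
    qed (use \<eta> in auto)
    also have "\<dots> = \<epsilon>" using M by (simp add: \<eta>_def)
    finally show "ham x q \<le> ham y q + \<epsilon>" by simp
  qed
qed

lemma C1_quadratic: "C1_with_gradient (\<lambda>x :: real ^ 'm. c * (norm (x - a))\<^sup>2) (\<lambda>x. (2 * c) *\<^sub>R (x - a))"
  unfolding C1_with_gradient_def
proof (intro conjI allI)
  fix y :: "real ^ 'm"
  have "((\<lambda>x. c * ((x - a) \<bullet> (x - a))) has_derivative (\<lambda>h. h \<bullet> ((2 * c) *\<^sub>R (y - a)))) (at y)"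
    by (auto intro!: derivative_eq_intros simp: inner_commute algebra_simps)
  then show "GDERIV (\<lambda>x. c * (norm (x - a))\<^sup>2) y :> (2 * c) *\<^sub>R (y - a)"
    by (simp add: gderiv_def power2_norm_eq_inner)
qed (intro continuous_intros)

text \<open>
  In the variables \<open>x\<close> and \<open>z = y - x\<close> the function is periodic in \<open>x\<close>, and for \<open>|z| > R\<close> the
  penalty makes it at most its value at the origin.  So it suffices to maximize over a compact set.
\<close>

lemma doubled_maximum:
  fixes w1 w2 :: "real ^ 'm \<Rightarrow> real"
  assumes w1: "int_periodic w1" "continuous_on UNIV w1" and w2: "int_periodic w2" "continuous_on UNIV w2"
    and c: "c > 0"
  obtains x y where "\<And>x' y'. w1 x' - w2 y' - c * (norm (x' - y'))\<^sup>2 \<le> w1 x - w2 y - c * (norm (x - y))\<^sup>2"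
proof -
  obtain W1 where W1: "\<And>y. norm (w1 y) \<le> W1" using int_periodic_norm_bound[OF w1] by metis
  obtain W2 where W2: "\<And>y. norm (w2 y) \<le> W2" using int_periodic_norm_bound[OF w2] by metis
  have W: "W1 \<ge> 0" "W2 \<ge> 0" using W1[of 0] W2[of 0] by (auto intro: order_trans[OF norm_ge_zero])
  define R where "R = sqrt (2 * (W1 + W2) / c)"
  define \<Psi> where "\<Psi> p = w1 (fst p) - w2 (fst p + snd p) - c * (norm (snd p))\<^sup>2" for p
  let ?S = "(unit_cube :: (real ^ 'm) set) \<times> cball (0 :: real ^ 'm) R"
  have R: "R \<ge> 0" "c * R\<^sup>2 = 2 * (W1 + W2)" using W c by (auto simp: R_def)
  have "continuous_on ?S \<Psi>"
    unfolding \<Psi>_def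
    by (intro continuous_intros continuous_on_compose2[OF w1(2)] continuous_on_compose2[OF w2(2)]) auto
  moreover have "compact ?S" by (intro compact_Times) auto
  moreover have "(0, 0) \<in> ?S" using R by (simp add: mem_box_cart)
  ultimately obtain p where p: "p \<in> ?S" "\<And>p'. p' \<in> ?S \<Longrightarrow> \<Psi> p' \<le> \<Psi> p"
    using continuous_attains_sup[of ?S \<Psi>] by blast
  have all: "\<Psi> (x, z) \<le> \<Psi> p" for x z
  proof (cases "norm z \<le> R")
    case True
    obtain k where k: "\<And>i. k $ i \<in> \<int>" "x + k \<in> unit_cube" using cube_translate by blast
    have "\<Psi> (x, z) = \<Psi> (x + k, z)"
      using int_periodicD[OF w1(1) k(1), of x] int_periodicD[OF w2(1) k(1), of "x + z"]
      by (simp add: \<Psi>_def ac_simps)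
    also have "\<dots> \<le> \<Psi> p" using True k by (intro p) auto
    finally show ?thesis .
  next
    case False
    have "R\<^sup>2 \<le> (norm z)\<^sup>2" using False R(1) by (intro power_mono) auto
    then have "c * R\<^sup>2 \<le> c * (norm z)\<^sup>2" using c by simp
    then have "\<Psi> (x, z) \<le> - W1 - W2"
      using R(2) W1[of x] W2[of "x + z"] by (simp add: \<Psi>_def)
    also have "\<dots> \<le> \<Psi> (0, 0)" using W1[of 0] W2[of 0] by (simp add: \<Psi>_def)
    also have "\<dots> \<le> \<Psi> p" using R(1) by (intro p) (simp add: mem_box_cart)
    finally show ?thesis .
  qed
  show ?thesis
  proof
    fix x' y'
    show "w1 x' - w2 y' - c * (norm (x' - y'))\<^sup>2
        \<le> w1 (fst p) - w2 (fst p + snd p) - c * (norm (fst p - (fst p + snd p)))\<^sup>2"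
      using all[of x' "y' - x'"] by (simp add: \<Psi>_def norm_minus_commute)
  qed
qed

text \<open>
  Doubling of variables.  At a maximum of \<open>w1 x - w2 y - c |x - y|\<^sup>2\<close> both functions are touched by
  quadratics with the same gradient \<open>q = 2c(x - y)\<close>, whence \<open>H1 \<le> ham x q\<close> and \<open>ham y q \<le> H2\<close>.
  By coercivity the second inequality bounds \<open>q\<close> by a number \<open>R\<close> that does not depend on \<open>c\<close>.  For
  large \<open>c\<close> the points \<open>x\<close> and \<open>y\<close> are therefore close, and the two values of \<open>ham\<close> differ by little.
\<close>

lemma comparison:
  assumes sub: "viscosity_subsolution (cell_op H1) w1" "int_periodic w1"
    and super: "viscosity_supersolution (cell_op H2) w2" "int_periodic w2"
  shows "H1 \<le> H2"
proof (rule field_le_epsilon)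
  fix \<epsilon> :: real assume e: "\<epsilon> > 0"
  have cont: "continuous_on UNIV w1" "continuous_on UNIV w2"
    using sub super unfolding viscosity_subsolution_def viscosity_supersolution_def by auto
  define R where "R = max 0 ((sqrt H2 + b_bound) / sqrt \<theta>)"
  obtain d where d: "d > 0" "\<And>x y q. \<lbrakk>dist x y < d; norm q \<le> R\<rbrakk> \<Longrightarrow> ham x q \<le> ham y q + \<epsilon>"
    using ham_uniformly_continuous[OF e, of R] by (auto simp: R_def)
  \<comment> \<open>With this penalty \<open>2 c |x - y| \<le> R\<close> forces \<open>|x - y| < d\<close>.\<close>
  define c where "c = (R + 1) / (2 * d)"
  have c: "c > 0" "R < 2 * c * d" using d(1) by (auto simp: c_def R_def add_nonneg_pos)
  obtain x y where xy: "\<And>x' y'. w1 x' - w2 y' - c * (norm (x' - y'))\<^sup>2 \<le> w1 x - w2 y - c * (norm (x - y))\<^sup>2"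
    using doubled_maximum[OF sub(2) cont(1) super(2) cont(2) c(1)] by blast
  define q where "q = (2 * c) *\<^sub>R (x - y)"
  have H1: "H1 \<le> ham x q"
  proof -
    have "\<forall>\<^sub>F z in nhds x. w1 z - c * (norm (z - y))\<^sup>2 \<le> w1 x - c * (norm (x - y))\<^sup>2"
    proof (intro always_eventually allI)
      show "w1 z - c * (norm (z - y))\<^sup>2 \<le> w1 x - c * (norm (x - y))\<^sup>2" for z using xy[of z y] by simp
    qed
    then have "cell_op H1 x ((2 * c) *\<^sub>R (x - y)) \<le> 0"
      using sub(1) C1_quadratic[of c y] unfolding viscosity_subsolution_def by blast
    then show ?thesis by (simp add: q_def)
  qed
  have H2: "ham y q \<le> H2"
  proof -
    have "\<forall>\<^sub>F z in nhds y. w2 y - (- c) * (norm (y - x))\<^sup>2 \<le> w2 z - (- c) * (norm (z - x))\<^sup>2"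
    proof (intro always_eventually allI)
      show "w2 y - (- c) * (norm (y - x))\<^sup>2 \<le> w2 z - (- c) * (norm (z - x))\<^sup>2" for z
        using xy[of x z] by (simp add: norm_minus_commute)
    qed
    then have "cell_op H2 y ((2 * (- c)) *\<^sub>R (y - x)) \<ge> 0"
      using super(1) C1_quadratic[of "- c" x] unfolding viscosity_supersolution_def by blast
    then show ?thesis by (simp add: q_def scaleR_right_diff_distrib)
  qed
  have "sqrt \<theta> * norm q \<le> sqrt H2 + b_bound" by (rule ham_coercive[OF H2])
  then have "norm q \<le> (sqrt H2 + b_bound) / sqrt \<theta>" using \<theta>_pos by (simp add: pos_le_divide_eq mult.commute)
  then have q: "norm q \<le> R" by (simp add: R_def)
  have "2 * c * norm (x - y) = norm q" using c by (simp add: q_def)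
  with q c(2) have "2 * c * norm (x - y) < 2 * c * d" by linarith
  then have "dist x y < d" using c(1) by (simp add: dist_norm)
  from d(2)[OF this q] H1 H2 show "H1 \<le> H2 + \<epsilon>" by linarith
qed

section \<open>The corrector solves the cell problem\<close>

text \<open>
  Start at \<open>y\<close> along the straight line with the velocity \<open>v\<close> that is optimal at \<open>y\<close> for the gradient \<open>q\<close>.
  Dynamic programming bounds the decrease of the test function along it from below by the
  gain in excess of \<open>crit * t\<close>, and differentiating at time zero gives \<open>gain + q \<bullet> v \<le> crit\<close>, where the left side is
  \<open>ham y q\<close>.
\<close>

lemma corrector_supersolution: "viscosity_supersolution (cell_op crit) corrector"
  unfolding viscosity_supersolution_def
proof (intro conjI allI impI)
  fix \<phi> :: "real ^ 'm \<Rightarrow> real" and g y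
  assume tst: "C1_with_gradient \<phi> g" and max: "\<forall>\<^sub>F z in nhds y. corrector y - \<phi> y \<le> corrector z - \<phi> z"
  define q where "q = g y"
  define e where "e = - (transpose (\<tau> y) *v q)"
  define v where "v = vel y e"
  let ?z = "\<lambda>t. y + t *\<^sub>R v"
  \<comment> \<open>The correction of \<open>e\<close> keeps the velocity equal to \<open>v\<close> away from \<open>y\<close>; it vanishes at time zero.\<close>
  define \<beta> where "\<beta> t = e + transpose (\<tau> (?z t)) *v gram_inverse (?z t) (\<tau> (?z t) *v (b (?z t) - e) - v /\<^sub>R 2)" for t
  have z: "continuous_on UNIV ?z" by (intro continuous_intros)
  have \<beta>: "continuous_on UNIV \<beta>"
    unfolding \<beta>_def using continuous_on_compose2[OF \<tau>_continuous z] continuous_on_compose2[OF b_continuous z]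
    by (intro continuous_intros gram_inverse_continuous z) auto
  have "vel (?z t) (\<beta> t) = v" for t
    by (simp add: vel_eq \<beta>_def gram_inverse matrix_vector_right_distrib matrix_vector_mult_diff_distrib)
  from run_line[OF \<beta> this] have r: "run \<beta> ?z" .
  have "gram_inverse y 0 = 0" using gram_inverse_unique[of y 0 0] by simp
  then have \<beta>0: "\<beta> 0 = e" by (simp add: \<beta>_def v_def vel_eq)
  let ?f = "\<lambda>t. gain (?z t) (\<beta> t)"
  have gain_e: "gain y e = ham y q - q \<bullet> v"
    using gain_plus_inner_vel[of y e q] by (simp add: v_def e_def)
  have f: "continuous_on UNIV ?f"
    unfolding gain_def using \<beta> continuous_on_compose2[OF b_continuous z] by (intro continuous_intros) auto
  have "((\<lambda>t. integral {0..t} ?f) has_vector_derivative ?f 0) (at 0 within {0..1})"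
    by (rule integral_has_vector_derivative) (use f continuous_on_subset in auto)
  then have dI: "((\<lambda>t. integral {0..t} ?f) has_real_derivative ham y q - q \<bullet> v) (at 0 within {0..1})"
    by (simp add: has_real_derivative_iff_has_vector_derivative \<beta>0 gain_e)
  have "(\<phi> has_derivative (\<lambda>h. h \<bullet> q)) (at y)"
    using tst unfolding C1_with_gradient_def gderiv_def q_def by blast
  then have d: "((\<lambda>t. \<phi> (?z t)) has_derivative (\<lambda>h. (h *\<^sub>R v) \<bullet> q)) (at 0)"
    by (intro has_derivative_compose[of ?z "\<lambda>h. h *\<^sub>R v" 0 UNIV \<phi> "\<lambda>h. h \<bullet> q"])
      (auto intro!: derivative_eq_intros)
  then have d\<phi>: "((\<lambda>t. \<phi> (?z t)) has_real_derivative q \<bullet> v) (at 0 within {0..1})"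
  proof -
    have "(\<lambda>h. (h *\<^sub>R v) \<bullet> q) = (*) (q \<bullet> v)"
      by (rule ext) (simp only: inner_scaleR_left inner_commute[of v q] mult.commute)
    with d show ?thesis
      unfolding has_field_derivative_def by (metis has_derivative_at_withinI)
  qed
  \<comment> \<open>This difference is nonnegative for small t and vanishes at zero.\<close>
  let ?D = "\<lambda>t. crit * t - integral {0..t} ?f - (\<phi> (?z t) - \<phi> y)"
  have D: "(?D has_real_derivative crit - ham y q) (at 0 within {0..1})"
    using DERIV_diff[OF DERIV_diff[OF DERIV_cmult_Id dI] DERIV_diff[OF d\<phi> DERIV_const[of "\<phi> y"]], of crit]
    by simp
  have "(?z \<longlongrightarrow> ?z 0) (at 0 within {0..1})"
    using z unfolding continuous_on_def by (meson tendsto_within_subset UNIV_I subset_UNIV)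
  then have "(?z \<longlongrightarrow> y) (at 0 within {0..1})" by simp
  then have ev: "\<forall>\<^sub>F t in at 0 within {0..1}. corrector y - \<phi> y \<le> corrector (?z t) - \<phi> (?z t)"
    using eventually_compose_filterlim[OF max] by blast
  have "\<forall>\<^sub>F t in at 0 within {0..1}. 0 \<le> (?D t - ?D 0) / (t - 0)"
  proof -
    have "\<forall>\<^sub>F t in at 0 within {0..1}. t \<in> {0..1::real}" by (simp add: eventually_at_filter)
    with ev show ?thesis
    proof eventually_elim
      case (elim t)
      then have "0 \<le> ?D t"
        using corrector_ge_run[OF r, of t] by (simp add: total_gain_def)
      then show ?case using elim by simp
    qed
  qed
  then have "0 \<le> crit - ham y q"
  proof (rule tendsto_lowerbound[rotated])
    show "((\<lambda>t. (?D t - ?D 0) / (t - 0)) \<longlongrightarrow> crit - ham y q) (at 0 within {0..1})"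
      using D unfolding has_field_derivative_iff by simp
  qed (simp add: at_within_Icc_at_right)
  then show "0 \<le> cell_op crit y (g y)" by (simp add: q_def)
qed (rule corrector_continuous)

text \<open>
  Near optimality and the boundedness of the corrector bound \<open>|\<beta>|\<^sup>2\<close> in the mean over \<open>[0,s]\<close> by a
  constant \<open>E\<close>.  By \<open>|\<beta>| \<le> 1/\<kappa> + \<kappa> |\<beta>|\<^sup>2\<close> the length of the path is at most
  \<open>M s + 2 \<tau>_bound \<kappa> E\<close>; first \<open>\<kappa>\<close> and then \<open>s\<close> is chosen small.
\<close>

lemma near_optimal_run_stays_close:
  assumes "\<rho> > 0"
  obtains s where "s > 0" "\<And>\<beta> Y t.
    \<lbrakk>run \<beta> Y; corrector (Y 0) \<le> total_gain \<beta> Y s - crit * s + corrector (Y s) + 1; 0 \<le> t; t \<le> s\<rbrakk>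
      \<Longrightarrow> dist (Y t) (Y 0) < \<rho>"
proof -
  obtain W where W: "\<And>y. norm (corrector y) \<le> W"
    using int_periodic_norm_bound[OF corrector_periodic corrector_continuous] by metis
  define E where "E = b_bound\<^sup>2 + 2 * W + 1"
  have E: "E > 0" using order_trans[OF norm_ge_zero W[of 0]] by (simp add: E_def add_nonneg_pos)
  define \<kappa> where "\<kappa> = \<rho> / (8 * \<tau>_bound * E)"
  have \<kappa>: "\<kappa> > 0" "2 * \<tau>_bound * (\<kappa> * E) = \<rho> / 4" using assms \<tau>_bound_pos E by (auto simp: \<kappa>_def)
  define M where "M = 2 * \<tau>_bound * (b_bound + 1 / \<kappa>)"
  have M: "M > 0" using \<tau>_bound_pos b_bound_pos \<kappa> by (simp add: M_def add_pos_pos)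
  define s where "s = min 1 (\<rho> / (4 * M))"
  have s: "s > 0" "s \<le> 1" "M * s \<le> \<rho> / 4"
    using M assms by (auto simp: s_def min_def field_simps)
  show ?thesis
  proof
    fix \<beta> Y t
    assume r: "run \<beta> Y" and opt: "corrector (Y 0) \<le> total_gain \<beta> Y s - crit * s + corrector (Y s) + 1"
      and t: "0 \<le> t" "t \<le> s"
    have sq: "(\<lambda>t. (norm (\<beta> t))\<^sup>2) integrable_on {0..t}" if "t \<ge> 0" for t using r that unfolding run_def by blast
    have "integral {0..t} (\<lambda>t. (norm (\<beta> t))\<^sup>2) \<le> integral {0..s} (\<lambda>t. (norm (\<beta> t))\<^sup>2)"
      using t by (intro integral_subset_le sq) auto
    also have "\<dots> \<le> integral {0..s} (\<lambda>t. b_bound\<^sup>2 - gain (Y t) (\<beta> t))"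
      using t r power_mono[OF norm_b_le norm_ge_zero, of _ 2]
      by (intro integral_le sq integrable_diff gain_integrable) (auto simp: gain_def)
    also have "\<dots> = b_bound\<^sup>2 * s - total_gain \<beta> Y s"
      using t r by (subst integral_diff) (auto simp: total_gain_def gain_integrable)
    also have "\<dots> \<le> E"
    proof -
      have "b_bound\<^sup>2 * s \<le> b_bound\<^sup>2" using s by (simp add: mult_left_le)
      moreover have "0 \<le> crit * s" using s crit_nonneg by simp
      ultimately show ?thesis
        using opt W[of "Y 0"] W[of "Y s"] by (simp add: E_def)
    qed
    finally have bE: "integral {0..t} (\<lambda>t. (norm (\<beta> t))\<^sup>2) \<le> E" .
    let ?g = "\<lambda>t. M + 2 * \<tau>_bound * (\<kappa> * (norm (\<beta> t))\<^sup>2)"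
    have vel: "((\<lambda>t. vel (Y t) (\<beta> t)) has_integral (Y t - Y 0)) {0..t}" using r t unfolding run_def by blast
    have "norm (integral {0..t} (\<lambda>t. vel (Y t) (\<beta> t))) \<le> integral {0..t} ?g"
    proof (rule integral_norm_bound_integral)
      fix u
      have "norm (\<beta> u) \<le> 1 / \<kappa> + \<kappa> * (norm (\<beta> u))\<^sup>2"
      proof (cases "norm (\<beta> u) \<le> 1 / \<kappa>")
        case False
        then have "1 \<le> \<kappa> * norm (\<beta> u)" using \<kappa> by (simp add: field_simps)
        then have "1 * norm (\<beta> u) \<le> \<kappa> * norm (\<beta> u) * norm (\<beta> u)" by (intro mult_right_mono) auto
        then have "norm (\<beta> u) \<le> \<kappa> * (norm (\<beta> u) * norm (\<beta> u))" by (simp add: mult.assoc)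
        moreover have "0 \<le> 1 / \<kappa>" using \<kappa> by simp
        ultimately show ?thesis unfolding power2_eq_square by linarith
      qed (use \<kappa> in \<open>simp add: add_increasing2\<close>)
      then have "norm (b (Y u) - \<beta> u) \<le> b_bound + (1 / \<kappa> + \<kappa> * (norm (\<beta> u))\<^sup>2)"
        using norm_triangle_ineq4[of "b (Y u)" "\<beta> u"] norm_b_le[of "Y u"] by linarith
      then have "2 * \<tau>_bound * norm (b (Y u) - \<beta> u) \<le> 2 * \<tau>_bound * (b_bound + (1 / \<kappa> + \<kappa> * (norm (\<beta> u))\<^sup>2))"
        using \<tau>_bound_pos by (intro mult_left_mono) auto
      then show "norm (vel (Y u) (\<beta> u)) \<le> ?g u"
        using norm_vel_le[of "Y u" "\<beta> u"] by (simp add: M_def distrib_left)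
    next
      show "?g integrable_on {0..t}"
        using sq[OF t(1)] by (intro integrable_add integrable_on_mult_right) auto
    qed (use vel in blast)
    also have "integral {0..t} ?g = M * t + 2 * \<tau>_bound * (\<kappa> * integral {0..t} (\<lambda>t. (norm (\<beta> t))\<^sup>2))"
      using sq[OF t(1)] t by (subst integral_add) (auto intro!: integrable_on_mult_right)
    also have "\<dots> \<le> M * s + 2 * \<tau>_bound * (\<kappa> * E)"
      using M \<tau>_bound_pos \<kappa>(1) t bE by (intro add_mono mult_left_mono) auto
    also have "\<dots> < \<rho>" using s \<kappa> assms by linarith
    finally show "dist (Y t) (Y 0) < \<rho>"
      using integral_unique[OF vel] by (simp add: dist_norm)
  qed (rule s)
qed

text \<open>
  A nearly optimal run over a short time \<open>s\<close> ends at a point close to \<open>y\<close>, where the first order expansion of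
  the test function at \<open>y\<close> has an error of at most \<open>\<eta>\<close> times the displacement.  This error is
  absorbed by tilting the gradient \<open>q\<close> by \<open>\<eta>\<close> in the direction of the displacement.  The integrand
  is then \<open>gain + p \<bullet> vel \<le> ham (Y t) p\<close> for the tilted gradient \<open>p\<close>, which is almost \<open>ham y q\<close>;
  a chain rule along the merely absolutely continuous \<open>Y\<close> is avoided.
\<close>

lemma corrector_subsolution: "viscosity_subsolution (cell_op crit) corrector"
  unfolding viscosity_subsolution_def
proof (intro conjI allI impI)
  fix \<phi> :: "real ^ 'm \<Rightarrow> real" and g y
  assume tst: "C1_with_gradient \<phi> g" and max: "\<forall>\<^sub>F z in nhds y. corrector z - \<phi> z \<le> corrector y - \<phi> y"
  define q where "q = g y"
  have "crit \<le> ham y q"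
  proof (rule field_le_epsilon)
    fix \<epsilon> :: real assume e: "\<epsilon> > 0"
    have "continuous_on UNIV (ham y)"
      unfolding ham_def by (intro continuous_intros)
    then obtain \<eta>0 where \<eta>0: "\<eta>0 > 0" "\<And>q'. dist q' q < \<eta>0 \<Longrightarrow> dist (ham y q') (ham y q) < \<epsilon> / 4"
      unfolding continuous_on_iff using e by (metis UNIV_I zero_less_divide_iff zero_less_numeral)
    define \<eta> where "\<eta> = min 1 (\<eta>0 / 2)"
    have \<eta>: "\<eta> > 0" "\<eta> \<le> 1" "\<eta> < \<eta>0" using \<eta>0(1) by (auto simp: \<eta>_def)
    obtain d where d: "d > 0"
      "\<And>x z p. \<lbrakk>dist x z < d; norm p \<le> norm q + 1\<rbrakk> \<Longrightarrow> ham x p \<le> ham z p + \<epsilon> / 4"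
      using ham_uniformly_continuous[of "\<epsilon> / 4" "norm q + 1"] e by auto
    have "(\<phi> has_derivative (\<lambda>h. h \<bullet> q)) (at y)"
      using tst unfolding C1_with_gradient_def gderiv_def q_def by blast
    then obtain r1 where r1: "r1 > 0"
      "\<And>z. norm (z - y) < r1 \<Longrightarrow> norm (\<phi> z - \<phi> y - (z - y) \<bullet> q) \<le> \<eta> * norm (z - y)"
      unfolding has_derivative_at_alt using \<eta>(1) by blast
    obtain r2 where r2: "r2 > 0" "\<And>z. dist z y < r2 \<Longrightarrow> corrector z - \<phi> z \<le> corrector y - \<phi> y"
      using max unfolding eventually_nhds_metric by blast
    define \<rho> where "\<rho> = min d (min r1 r2)"
    have \<rho>: "\<rho> > 0" "\<rho> \<le> d" "\<rho> \<le> r1" "\<rho> \<le> r2" using d(1) r1(1) r2(1) by (auto simp: \<rho>_def)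
    obtain s where s: "s > 0" "\<And>\<beta> Y t.
        \<lbrakk>run \<beta> Y; corrector (Y 0) \<le> total_gain \<beta> Y s - crit * s + corrector (Y s) + 1; 0 \<le> t; t \<le> s\<rbrakk>
        \<Longrightarrow> dist (Y t) (Y 0) < \<rho>"
      using near_optimal_run_stays_close[OF \<rho>(1)] by blast
    obtain \<beta> Y where r: "run \<beta> Y" "Y 0 = y"
        "corrector y \<le> total_gain \<beta> Y s - crit * s + corrector (Y s) + min 1 (\<epsilon> / 4 * s)"
      using corrector_le_run[of s "min 1 (\<epsilon> / 4 * s)" y] s(1) e by auto
    have close: "dist (Y t) y < \<rho>" if "0 \<le> t" "t \<le> s" for t
      using s(2)[OF r(1) _ that] r(2,3) by simp
    let ?\<Delta> = "Y s - y"
    define p where "p = q + \<eta> *\<^sub>R sgn ?\<Delta>"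
    have "norm (p - q) \<le> \<eta>" using \<eta>(1) by (simp add: p_def norm_sgn)
    then have p: "dist p q < \<eta>0" "norm p \<le> norm q + 1"
      using \<eta> norm_triangle_ineq2[of p q] by (auto simp: dist_norm)
    have "sgn ?\<Delta> \<bullet> ?\<Delta> = norm ?\<Delta>"
      by (cases "?\<Delta> = 0") (simp_all add: sgn_div_norm power2_eq_square flip: power2_norm_eq_inner)
    then have p\<Delta>: "p \<bullet> ?\<Delta> = q \<bullet> ?\<Delta> + \<eta> * norm ?\<Delta>" by (simp add: p_def inner_add_left)
    have "corrector (Y s) - corrector y \<le> \<phi> (Y s) - \<phi> y"
      using r2(2)[of "Y s"] close[of s] s(1) \<rho> by simp
    also have "\<dots> \<le> p \<bullet> ?\<Delta>"
      using r1(2)[of "Y s"] close[of s] s(1) \<rho> p\<Delta> by (simp add: dist_norm inner_commute)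
    finally have 1: "0 \<le> total_gain \<beta> Y s + p \<bullet> ?\<Delta> - crit * s + \<epsilon> / 4 * s"
      using r(3) by simp
    have "((\<lambda>t. gain (Y t) (\<beta> t) + p \<bullet> vel (Y t) (\<beta> t)) has_integral (total_gain \<beta> Y s + p \<bullet> ?\<Delta>)) {0..s}"
    proof (rule has_integral_add)
      show "((\<lambda>t. gain (Y t) (\<beta> t)) has_integral total_gain \<beta> Y s) {0..s}"
        unfolding total_gain_def using gain_integrable[OF r(1)] s(1) by (simp add: integrable_integral)
      have "((\<lambda>t. vel (Y t) (\<beta> t)) has_integral ?\<Delta>) {0..s}"
        using r(1) s(1) unfolding run_def r(2)[symmetric] by simp
      from has_integral_linear[OF this bounded_linear_inner_right[of p]]
      show "((\<lambda>t. p \<bullet> vel (Y t) (\<beta> t)) has_integral (p \<bullet> ?\<Delta>)) {0..s}" by (simp add: o_def)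
    qed
    moreover have "((\<lambda>t. ham y q + \<epsilon> / 2) has_integral (s - 0) *\<^sub>R (ham y q + \<epsilon> / 2)) {0..s}"
      using has_integral_const_real[of "ham y q + \<epsilon> / 2" 0 s] s(1) by simp
    ultimately have "total_gain \<beta> Y s + p \<bullet> ?\<Delta> \<le> (s - 0) *\<^sub>R (ham y q + \<epsilon> / 2)"
    proof (rule has_integral_le)
      fix t assume t: "t \<in> {0..s}"
      have "gain (Y t) (\<beta> t) + p \<bullet> vel (Y t) (\<beta> t) \<le> ham (Y t) p"
        unfolding gain_plus_inner_vel by simp
      also have "\<dots> \<le> ham y p + \<epsilon> / 4" using close[of t] t \<rho> p(2) by (intro d(2)) auto
      also have "ham y p \<le> ham y q + \<epsilon> / 4" using \<eta>0(2)[OF p(1)] unfolding dist_real_def by linarith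
      finally show "gain (Y t) (\<beta> t) + p \<bullet> vel (Y t) (\<beta> t) \<le> ham y q + \<epsilon> / 2" by simp
    qed
    with 1 have "s * crit \<le> s * (ham y q + \<epsilon> / 2 + \<epsilon> / 4)" by (simp add: algebra_simps)
    then have "crit \<le> ham y q + \<epsilon> / 2 + \<epsilon> / 4" using s(1) by simp
    then show "crit \<le> ham y q + \<epsilon>" using e by simp
  qed
  then show "cell_op crit y (g y) \<le> 0" by (simp add: q_def)
qed (rule corrector_continuous)

theorem cell_constant_unique:
  "(\<exists>w. int_periodic w \<and> viscosity_solution (cell_op H) w) \<longleftrightarrow> H = crit"
  using comparison corrector_subsolution corrector_supersolution corrector_periodic
  unfolding viscosity_solution_def by (metis order_antisym)

section \<open>The discounted payoff\<close>

abbreviation payoff_density :: "real \<Rightarrow> (real \<Rightarrow> real ^ 'r) \<Rightarrow> (real \<Rightarrow> real ^ 'm) \<Rightarrow> real \<Rightarrow> real" where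
  "payoff_density \<delta> \<beta> Y t \<equiv> gain (Y t) (\<beta> t) * exp (- \<delta> * t)"

text \<open>
  The second mean value theorem also yields integrability of the product with a monotone weight.
\<close>

lemma exp_weight_integrable:
  assumes "f integrable_on {0..T}" "\<delta> > 0"
  shows "(\<lambda>t. f t * exp (- \<delta> * t)) integrable_on {0..T :: real}"
proof (cases "T \<ge> 0")
  case True
  obtain c where "((\<lambda>t. - exp (- \<delta> * t) * f t) has_integral
      (- exp (- \<delta> * 0) * integral {0..c} f + - exp (- \<delta> * T) * integral {c..T} f)) {0..T}"
    using second_mean_value_theorem_full[OF assms(1) True, of "\<lambda>t. - exp (- \<delta> * t)"] assms(2) by auto
  then have "(\<lambda>t. - (- exp (- \<delta> * t) * f t)) integrable_on {0..T}"
    by (intro integrable_neg has_integral_integrable)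
  then show ?thesis by (simp add: mult.commute)
qed auto

lemma payoff_density_absolutely_integrable:
  assumes r: "run \<beta> Y" and "T \<ge> 0" "\<delta> > 0"
  shows "payoff_density \<delta> \<beta> Y absolutely_integrable_on {0..T}"
proof -
  have "(\<lambda>t. (norm (b (Y t)))\<^sup>2) integrable_on {0..T}"
    using b_continuous by (intro run_comp_integrable[OF r] continuous_intros)
  then have "(\<lambda>t. (norm (b (Y t)))\<^sup>2 * exp (- \<delta> * t)) absolutely_integrable_on {0..T}"
    by (intro nonnegative_absolutely_integrable_1 exp_weight_integrable assms) auto
  moreover have "(\<lambda>t. (norm (\<beta> t))\<^sup>2 * exp (- \<delta> * t)) absolutely_integrable_on {0..T}"
    using r assms unfolding run_def
    by (intro nonnegative_absolutely_integrable_1 exp_weight_integrable) auto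
  ultimately have "(\<lambda>t. (norm (b (Y t)))\<^sup>2 * exp (- \<delta> * t) - (norm (\<beta> t))\<^sup>2 * exp (- \<delta> * t))
      absolutely_integrable_on {0..T}" by (rule set_integral_diff(1))
  then show ?thesis by (simp add: gain_def left_diff_distrib)
qed

text \<open>
  The density is at most a multiple of the exponential weight, so its positive part has a finite
  integral.
\<close>

lemma payoff_density_LIMSEQ:
  assumes r: "run \<beta> Y" and d: "\<delta> > 0"
  shows "(\<lambda>n. ereal (integral {0..real n} (payoff_density \<delta> \<beta> Y)))
    \<longlonglongrightarrow> extended_integral (lebesgue_on {0..}) (payoff_density \<delta> \<beta> Y)"
proof (rule extended_integral_LIMSEQ)
  have "(\<integral>\<^sup>+t. ennreal (payoff_density \<delta> \<beta> Y t) \<partial>lebesgue_on {0..})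
      = (\<integral>\<^sup>+t. ennreal (payoff_density \<delta> \<beta> Y t) * indicator {0..} t \<partial>lborel)"
    by (simp add: nn_integral_restrict_space nn_integral_completion)
  also have "\<dots> \<le> (\<integral>\<^sup>+t. ennreal (b_bound\<^sup>2 * exp (- \<delta> * t)) * indicator {0..} t \<partial>lborel)"
    by (intro nn_integral_mono mult_right_mono ennreal_leI mult_right_mono gain_le) auto
  also have "\<dots> = ennreal (b_bound\<^sup>2 * (exp (- \<delta> * 0) / \<delta>))"
    by (rule nn_integral_has_integral_lebesgue')
      (use has_integral_mult_right[OF has_integral_exp_minus_to_infinity[OF d, of 0], of "b_bound\<^sup>2"] in auto)
  also have "\<dots> < \<infinity>" by simp
  finally show "(\<integral>\<^sup>+t. ennreal (payoff_density \<delta> \<beta> Y t) \<partial>lebesgue_on {0..}) < \<infinity>" .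
qed (use payoff_density_absolutely_integrable r d in auto)

lemma exp_has_integral:
  fixes \<delta> :: real
  assumes "\<delta> > 0" "T \<ge> 0"
  shows "((\<lambda>t. exp (- \<delta> * t)) has_integral (1 - exp (- \<delta> * T)) / \<delta>) {0..T}"
proof -
  have "((\<lambda>t. exp (- \<delta> * t)) has_integral (- exp (- \<delta> * T) / \<delta> - (- exp (- \<delta> * 0) / \<delta>))) {0..T}"
    by (rule fundamental_theorem_of_calculus[where f = "\<lambda>t. - exp (- \<delta> * t) / \<delta>"])
      (use assms in \<open>auto intro!: derivative_eq_intros simp flip: has_real_derivative_iff_has_vector_derivative\<close>)
  then show ?thesis using assms(1) by (simp add: diff_divide_distrib)
qed

text \<open>
  The weight decreases from \<open>1\<close> to \<open>exp (- \<delta> * T)\<close>, so the second mean value theorem expresses the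
  discounted integral of \<open>gain - crit\<close> by the undiscounted excesses at an intermediate time and
  at time \<open>T\<close>.
\<close>

lemma payoff_density_integral:
  assumes r: "run \<beta> Y" and "T \<ge> 0" "\<delta> > 0"
  obtains \<xi> where "0 \<le> \<xi>" "\<xi> \<le> T"
    "integral {0..T} (payoff_density \<delta> \<beta> Y) = crit * ((1 - exp (- \<delta> * T)) / \<delta>) +
      (total_gain \<beta> Y \<xi> - crit * \<xi>) + exp (- \<delta> * T) *
      ((total_gain \<beta> Y T - crit * T) - (total_gain \<beta> Y \<xi> - crit * \<xi>))"
proof -
  let ?f = "\<lambda>t. gain (Y t) (\<beta> t) - crit"
  have g: "(\<lambda>t. gain (Y t) (\<beta> t)) integrable_on {s..t}" if "0 \<le> s" for s t
    by (rule gain_integrable_sub[OF r that])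
  have f: "?f integrable_on {s..t}" if "0 \<le> s" for s t
    using g[OF that] by (intro integrable_diff) auto
  have A: "integral {0..t} ?f = total_gain \<beta> Y t - crit * t" if "0 \<le> t" for t
    using that by (subst integral_diff) (auto simp: g total_gain_def)
  obtain \<xi> where \<xi>: "\<xi> \<in> {0..T}" and I: "((\<lambda>t. - exp (- \<delta> * t) * ?f t) has_integral
      (- exp (- \<delta> * 0) * integral {0..\<xi>} ?f + - exp (- \<delta> * T) * integral {\<xi>..T} ?f)) {0..T}"
    using second_mean_value_theorem_full[OF f[of 0 T] assms(2), of "\<lambda>t. - exp (- \<delta> * t)"] assms(3) by auto
  have A': "integral {\<xi>..T} ?f = (total_gain \<beta> Y T - crit * T) - (total_gain \<beta> Y \<xi> - crit * \<xi>)"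
    using Henstock_Kurzweil_Integration.integral_combine[of 0 \<xi> T ?f] \<xi> f[of 0 T] A[of \<xi>] A[of T] by simp
  have "((\<lambda>t. crit * exp (- \<delta> * t) - (- exp (- \<delta> * t) * ?f t)) has_integral
      (crit * ((1 - exp (- \<delta> * T)) / \<delta>) - (- exp (- \<delta> * 0) * integral {0..\<xi>} ?f + - exp (- \<delta> * T) * integral {\<xi>..T} ?f))) {0..T}"
    by (intro has_integral_diff I has_integral_mult_right exp_has_integral assms)
  moreover have "crit * exp (- \<delta> * t) - (- exp (- \<delta> * t) * ?f t) = payoff_density \<delta> \<beta> Y t" for t
    by (simp add: algebra_simps)
  ultimately have "integral {0..T} (payoff_density \<delta> \<beta> Y) =
      crit * ((1 - exp (- \<delta> * T)) / \<delta>) - (- exp (- \<delta> * 0) * integral {0..\<xi>} ?f + - exp (- \<delta> * T) * integral {\<xi>..T} ?f)"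
    by (simp add: integral_unique)
  then have "integral {0..T} (payoff_density \<delta> \<beta> Y) =
      crit * ((1 - exp (- \<delta> * T)) / \<delta>) + integral {0..\<xi>} ?f + exp (- \<delta> * T) * integral {\<xi>..T} ?f"
    by simp
  with that \<xi> show ?thesis unfolding A' using A[of \<xi>] by auto
qed

lemma payoff_le:
  assumes r: "run \<beta> Y" and d: "\<delta> > 0"
  shows "extended_integral (lebesgue_on {0..}) (payoff_density \<delta> \<beta> Y) \<le> ereal (crit / \<delta> + 2 * excess_bound)"
proof (rule LIMSEQ_le_const2[OF payoff_density_LIMSEQ[OF r d]])
  have "integral {0..real n} (payoff_density \<delta> \<beta> Y) \<le> crit / \<delta> + 2 * excess_bound" for n
  proof -
    let ?A = "\<lambda>t. total_gain \<beta> Y t - crit * t"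
    obtain \<xi> where \<xi>: "0 \<le> \<xi>" "\<xi> \<le> real n" and
      I: "integral {0..real n} (payoff_density \<delta> \<beta> Y) = crit * ((1 - exp (- \<delta> * real n)) / \<delta>) +
        ?A \<xi> + exp (- \<delta> * real n) * (?A (real n) - ?A \<xi>)"
      using payoff_density_integral[OF r _ d, of "real n"] by auto
    have e: "exp (- \<delta> * real n) \<le> 1" using d by simp
    have "exp (- \<delta> * real n) * (?A (real n) - ?A \<xi>) \<le> exp (- \<delta> * real n) * excess_bound"
      using excess_increment_le[OF r \<xi>] by (intro mult_left_mono) auto
    also have "\<dots> \<le> 1 * excess_bound" using e excess_bound_nonneg by (intro mult_right_mono) auto
    finally have 1: "exp (- \<delta> * real n) * (?A (real n) - ?A \<xi>) \<le> excess_bound" by simp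
    have "crit * ((1 - exp (- \<delta> * real n)) / \<delta>) \<le> crit * (1 / \<delta>)"
      using crit_nonneg d by (intro mult_left_mono divide_right_mono) auto
    with 1 I excess_le[OF r \<xi>(1)] show ?thesis by simp
  qed
  then show "\<exists>N. \<forall>n\<ge>N. ereal (integral {0..real n} (payoff_density \<delta> \<beta> Y)) \<le> ereal (crit / \<delta> + 2 * excess_bound)"
    by auto
qed

text \<open>
  A run whose excess at time \<open>T\<close> is bounded below has excess bounded below at every earlier time,
  since the increments are bounded above.  The run is made to rest after time \<open>T\<close>, where it gains
  nothing.
\<close>

lemma payoff_ge:
  assumes d: "\<delta> > 0"
  obtains \<beta> Y where "run \<beta> Y" "Y 0 = y"
    "extended_integral (lebesgue_on {0..}) (payoff_density \<delta> \<beta> Y) \<ge> ereal (crit / \<delta> - (7 * excess_bound + 3))"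
proof -
  \<comment> \<open>This horizon makes the part \<open>crit * exp (- \<delta> * T) / \<delta>\<close> lost by resting after T at most one.\<close>
  define T where "T = ln ((crit + 1) / \<delta> + 1) / \<delta>"
  have arg: "(crit + 1) / \<delta> + 1 \<ge> 1" using crit_nonneg d by simp
  then have T: "T \<ge> 0" using d by (simp add: T_def)
  have "crit * (exp (- \<delta> * T) / \<delta>) \<le> 1"
  proof -
    have "exp (- \<delta> * T) = 1 / ((crit + 1) / \<delta> + 1)"
      using arg d by (simp add: T_def exp_minus exp_ln inverse_eq_divide)
    also have "\<dots> = \<delta> / (crit + 1 + \<delta>)" using d crit_nonneg by (simp add: field_simps)
    finally have "crit * (exp (- \<delta> * T) / \<delta>) = crit / (crit + 1 + \<delta>)" using d by simp
    then show ?thesis using d crit_nonneg by simp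
  qed
  then have cT: "crit * ((1 - exp (- \<delta> * T)) / \<delta>) \<ge> crit / \<delta> - 1"
    by (simp add: diff_divide_distrib right_diff_distrib)
  obtain \<beta> Y where r: "run \<beta> Y" "Y 0 = y" "total_gain \<beta> Y T - crit * T \<ge> - (2 * excess_bound + 1)"
    using excess_ge[OF T] by blast
  let ?A = "\<lambda>t. total_gain \<beta> Y t - crit * t"
  have I: "integral {0..T} (payoff_density \<delta> \<beta> Y) \<ge> crit / \<delta> - (7 * excess_bound + 3)"
  proof -
    obtain \<xi> where \<xi>: "0 \<le> \<xi>" "\<xi> \<le> T" and
      I: "integral {0..T} (payoff_density \<delta> \<beta> Y) = crit * ((1 - exp (- \<delta> * T)) / \<delta>) +
        ?A \<xi> + exp (- \<delta> * T) * (?A T - ?A \<xi>)"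
      using payoff_density_integral[OF r(1) T d] by auto
    have "?A \<xi> \<ge> - (3 * excess_bound + 1)" using excess_increment_le[OF r(1) \<xi>] r(3) by simp
    moreover have "exp (- \<delta> * T) * (?A T - ?A \<xi>) \<ge> - (3 * excess_bound + 1)"
    proof -
      have "?A T - ?A \<xi> \<ge> - (3 * excess_bound + 1)" using excess_le[OF r(1) \<xi>(1)] r(3) by simp
      then have "exp (- \<delta> * T) * (- (3 * excess_bound + 1)) \<le> exp (- \<delta> * T) * (?A T - ?A \<xi>)"
        by (intro mult_left_mono) auto
      moreover have "exp (- \<delta> * T) * (3 * excess_bound + 1) \<le> 1 * (3 * excess_bound + 1)"
        using d T excess_bound_nonneg by (intro mult_right_mono) auto
      then have "- (3 * excess_bound + 1) \<le> exp (- \<delta> * T) * (- (3 * excess_bound + 1))"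
        by (simp only: mult_minus_right neg_le_iff_le mult_1_left)
      ultimately show ?thesis by (rule order_trans[rotated])
    qed
    ultimately show ?thesis using I cT excess_bound_nonneg by linarith
  qed
  let ?\<beta> = "glue T \<beta> (\<lambda>_. b (Y T))" and ?Y = "glue T Y (\<lambda>_. Y T)"
  have run: "run ?\<beta> ?Y" by (rule run_glue[OF r(1) run_stationary(1) T]) simp
  have "extended_integral (lebesgue_on {0..}) (payoff_density \<delta> ?\<beta> ?Y) \<ge> ereal (crit / \<delta> - (7 * excess_bound + 3))"
  proof (rule LIMSEQ_le_const[OF payoff_density_LIMSEQ[OF run d]])
    have "ereal (crit / \<delta> - (7 * excess_bound + 3)) \<le> ereal (integral {0..real n} (payoff_density \<delta> ?\<beta> ?Y))"
      if "n \<ge> nat \<lceil>T\<rceil>" for n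
    proof -
      have n: "T \<le> real n" using that by linarith
      have "(payoff_density \<delta> \<beta> Y has_integral integral {0..T} (payoff_density \<delta> \<beta> Y)) {0..T}"
        using payoff_density_absolutely_integrable[OF r(1) T d]
        by (simp add: absolutely_integrable_on_def integrable_integral)
      then have "(payoff_density \<delta> ?\<beta> ?Y has_integral (integral {0..T} (payoff_density \<delta> \<beta> Y) + 0)) {0..real n}"
        by (rule has_integral_glue[OF T n _ has_integral_0]) (auto simp: glue_def gain_def)
      then have "integral {0..real n} (payoff_density \<delta> ?\<beta> ?Y) = integral {0..T} (payoff_density \<delta> \<beta> Y)"
        by (simp add: integral_unique)
      then show ?thesis using I by simp
    qed
    then show "\<exists>N. \<forall>n\<ge>N. ereal (crit / \<delta> - (7 * excess_bound + 3)) \<le> ereal (integral {0..real n} (payoff_density \<delta> ?\<beta> ?Y))"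
      by blast
  qed
  moreover have "?Y 0 = y" using glue_0[OF T, of "\<lambda>_. Y T" Y] r(2) by simp
  ultimately show ?thesis by (intro that[OF run])
qed

section \<open>Explicit formulas\<close>

text \<open>
  If \<open>\<tau> b = 0\<close>, the control zero keeps a run at rest and earns \<open>|b(y)|\<^sup>2\<close> per unit time.
\<close>

lemma crit_eq_max:
  assumes "\<And>y. \<tau> y *v b y = 0"
  shows "\<exists>y. crit = (norm (b y))\<^sup>2" "(norm (b y))\<^sup>2 \<le> crit"
proof -
  show le: "(norm (b y))\<^sup>2 \<le> crit" for y
    unfolding crit_def
  proof (rule cINF_greatest)
    fix T :: real assume "T \<in> {0<..}"
    then have T: "T > 0" by simp
    have "run (\<lambda>_. 0) (\<lambda>_. y)"
      using run_line[of "\<lambda>_. 0" y 0] assms[of y] by (simp add: vel_def)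
    from total_gain_le_max_gain[OF _ this, of T] T show "(norm (b y))\<^sup>2 \<le> max_gain T / T"
      by (simp add: total_gain_def gain_def pos_le_divide_eq mult.commute)
  qed simp
  have "int_periodic (\<lambda>y. (norm (b y))\<^sup>2)" using b_periodic by (simp add: int_periodic_def)
  moreover have "continuous_on UNIV (\<lambda>y. (norm (b y))\<^sup>2)" by (intro continuous_intros b_continuous)
  ultimately have "compact (range (\<lambda>y. (norm (b y))\<^sup>2))" by (rule int_periodic_compact_range)
  then obtain z where z: "\<And>y. (norm (b y))\<^sup>2 \<le> (norm (b z))\<^sup>2"
    using compact_attains_sup[of "range (\<lambda>y. (norm (b y))\<^sup>2)"] by auto
  have "max_gain 1 \<le> (norm (b z))\<^sup>2"
  proof (rule max_gain_leI)
    fix \<beta> Y assume r: "run \<beta> Y"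
    have "total_gain \<beta> Y 1 \<le> integral {0..1} (\<lambda>t :: real. (norm (b z))\<^sup>2)"
      unfolding total_gain_def
    proof (intro integral_le gain_integrable[OF r])
      show "gain (Y t) (\<beta> t) \<le> (norm (b z))\<^sup>2" for t
        using z[of "Y t"] zero_le_power2[of "norm (\<beta> t)"] unfolding gain_def by linarith
    qed auto
    then show "total_gain \<beta> Y 1 \<le> (norm (b z))\<^sup>2" by simp
  qed
  then have "crit \<le> (norm (b z))\<^sup>2" using crit_le[of 1] by simp
  with le[of z] show "\<exists>y. crit = (norm (b y))\<^sup>2" by (intro exI[of _ z] antisym)
qed

text \<open>
  Where a test function touches a differentiable function the gradients agree, so a classical
  solution is a viscosity solution.
\<close>

lemma classical_solution_crit:
  assumes per: "int_periodic w" and D: "\<And>y. GDERIV w y :> g y" and H: "\<And>y. ham y (g y) = H"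
  shows "H = crit"
proof -
  have c: "continuous_on UNIV w"
    using D unfolding gderiv_def by (meson continuous_at_imp_continuous_on has_derivative_continuous)
  have grad: "g' y = g y" if tst: "C1_with_gradient \<phi> g'"
    and ext: "(\<forall>\<^sub>F z in nhds y. w z - \<phi> z \<le> w y - \<phi> y) \<or> (\<forall>\<^sub>F z in nhds y. w y - \<phi> y \<le> w z - \<phi> z)"
    for \<phi> g' y
  proof -
    have d: "((\<lambda>z. w z - \<phi> z) has_derivative (\<lambda>h. h \<bullet> g y - h \<bullet> g' y)) (at y)"
      using D[of y] tst unfolding C1_with_gradient_def gderiv_def by (intro has_derivative_diff) auto
    from ext obtain S where S: "open S" "y \<in> S"
      "(\<forall>z\<in>S. w z - \<phi> z \<le> w y - \<phi> y) \<or> (\<forall>z\<in>S. w y - \<phi> y \<le> w z - \<phi> z)"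
      unfolding eventually_nhds by blast
    have "(\<lambda>h. h \<bullet> g y - h \<bullet> g' y) = (\<lambda>h. 0)"
      by (rule differential_zero_maxmin[OF S(2,1) d]) (use S(3) in auto)
    then have "(g y - g' y) \<bullet> (g y - g' y) = 0" by (metis inner_diff_right)
    then show ?thesis by simp
  qed
  have "viscosity_solution (cell_op H) w"
    unfolding viscosity_solution_def viscosity_subsolution_def viscosity_supersolution_def
  proof (intro conjI allI impI c)
    fix \<phi> :: "real ^ 'm \<Rightarrow> real" and g' y assume tst: "C1_with_gradient \<phi> g'"
    show "H - ham y (g' y) \<le> 0" if "\<forall>\<^sub>F z in nhds y. w z - \<phi> z \<le> w y - \<phi> y"
      using grad[OF tst disjI1[OF that]] H[of y] by simp
    show "0 \<le> H - ham y (g' y)" if "\<forall>\<^sub>F z in nhds y. w y - \<phi> y \<le> w z - \<phi> z"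
      using grad[OF tst disjI2[OF that]] H[of y] by simp
  qed
  then show ?thesis using cell_constant_unique per by blast
qed

text \<open>
  With \<open>r\<close> and \<open>s\<close> the only entries of \<open>\<tau>\<close> and \<open>b\<close>, the equation \<open>(r F' + s)\<^sup>2 = C\<^sup>2\<close> is solved by an
  antiderivative \<open>F\<close> of \<open>(C - s)/r\<close>.  It is periodic if the integral of \<open>(C - s)/r\<close> over a period
  vanishes, which determines \<open>C\<close>.
\<close>

lemma crit_one_dim:
  fixes j :: 'm and k :: 'r
  assumes j: "(UNIV :: 'm set) = {j}" and k: "(UNIV :: 'r set) = {k}"
  shows "crit = (integral {0..1} (\<lambda>s. b (vec s) $ k / \<tau> (vec s) $ j $ k))\<^sup>2 /
    (integral {0..1} (\<lambda>s. 1 / \<tau> (vec s) $ j $ k))\<^sup>2"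
proof -
  define r where "r t = \<tau> (vec t) $ j $ k" for t
  define s where "s t = b (vec t) $ k" for t
  have vec: "vec (y $ j) = y" for y :: "real ^ 'm"
    using j by (metis vec_eq_iff vec_component singletonD UNIV_I)
  have nrm: "(norm x)\<^sup>2 = (x $ k)\<^sup>2" for x :: "real ^ 'r"
    unfolding power2_norm_eq_inner inner_vec_def k by (simp add: power2_eq_square)
  have trans: "(transpose (\<tau> y) *v q) $ k = r (y $ j) * q $ j" for y q
    by (simp add: matrix_vector_mult_def transpose_def j r_def vec)
  have ham: "ham y q = (r (y $ j) * q $ j + s (y $ j))\<^sup>2" for y q
    by (simp add: ham_def nrm trans s_def vec)
  have "continuous_on UNIV (\<lambda>t. vec t :: real ^ 'm)"
    by (intro linear_continuous_on linear_conv_bounded_linear[THEN iffD1]) (auto intro: linearI simp: vec_eq_iff)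
  then have rc: "continuous_on UNIV r" and sc: "continuous_on UNIV s"
    unfolding r_def s_def
    using continuous_on_compose2[OF \<tau>_continuous] continuous_on_compose2[OF b_continuous]
    by (auto intro!: continuous_intros)
  have rnz: "r t \<noteq> 0" for t
  proof
    assume "r t = 0"
    then have "(norm (transpose (\<tau> (vec t)) *v (axis j 1)))\<^sup>2 = 0"
      by (simp add: nrm trans)
    moreover have "axis j (1 :: real) \<noteq> 0" by (simp add: axis_eq_0_iff)
    ultimately show False
      using nondegenerate[of "axis j 1" "vec t"] mult_nonneg_nonneg[of \<theta> "(norm (axis j (1 :: real)))\<^sup>2"] \<theta>_pos
      by simp
  qed
  have per: "r (t + 1) = r t" "s (t + 1) = s t" for t
  proof -
    have "vec (t + 1) = (vec t + 1 :: real ^ 'm)" by (simp add: vec_eq_iff)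
    moreover have "\<tau> (vec t + 1) = \<tau> (vec t)" "b (vec t + 1) = b (vec t)"
      by (rule int_periodicD[OF \<tau>_periodic] int_periodicD[OF b_periodic]; simp)+
    ultimately show "r (t + 1) = r t" "s (t + 1) = s t" by (simp_all add: r_def s_def)
  qed
  have invc: "continuous_on S (\<lambda>t. 1 / r t)" "continuous_on S (\<lambda>t. s t / r t)" for S
    using rnz rc sc by (auto intro!: continuous_intros intro: continuous_on_subset)
  let ?I = "integral {0..1} (\<lambda>t. 1 / r t)" and ?J = "integral {0..1} (\<lambda>t. s t / r t)"
  have I: "((\<lambda>t. 1 / r t) has_integral ?I) {0..1}" and J: "((\<lambda>t. s t / r t) has_integral ?J) {0..1}"
    by (intro integrable_integral integrable_continuous_interval invc)+
  \<comment> \<open>The entry r has no zero, so it has a constant sign and so has the integral of 1/r.\<close>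
  have "?I \<noteq> 0"
  proof
    assume "?I = 0"
    have sgn: "r t * r u > 0" for t u
    proof (rule ccontr)
      assume "\<not> r t * r u > 0"
      then have "r t < 0 \<and> r u > 0 \<or> r t > 0 \<and> r u < 0"
        using rnz[of t] rnz[of u] by (auto simp: not_less mult_le_0_iff)
      moreover have "connected (range r)" by (intro connected_continuous_image rc) simp
      ultimately have "0 \<in> range r"
        unfolding connected_iff_interval by (meson less_imp_le rangeI)
      then show False using rnz by auto
    qed
    have "((\<lambda>t. r 0 * (1 / r t)) has_integral r 0 * ?I) {0..1}" by (rule has_integral_mult_right[OF I])
    then have i: "((\<lambda>t. r 0 / r t) has_integral 0) (cbox 0 1)" using \<open>?I = 0\<close> by simp
    have "r 0 / r 0 = 0"
    proof (rule has_integral_0_cbox_imp_0[OF _ _ i])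
      show "continuous_on (cbox 0 1) (\<lambda>t. r 0 / r t)"
        using rnz rc by (auto intro!: continuous_intros intro: continuous_on_subset)
      show "0 \<le> r 0 / r t" for t
        using sgn[of 0 t] by (auto simp: zero_le_divide_iff zero_less_mult_iff)
    qed auto
    then show False using rnz[of 0] by simp
  qed
  define C where "C = ?J / ?I"
  define f where "f t = (C - s t) / r t" for t
  have fc: "continuous_on UNIV f"
    unfolding f_def using rnz rc sc by (intro continuous_intros) auto
  have "((\<lambda>t. C * (1 / r t) - s t / r t) has_integral C * ?I - ?J) {0..1}"
    by (intro has_integral_diff has_integral_mult_right I J)
  then have fi: "(f has_integral 0) {0..1}"
    using \<open>?I \<noteq> 0\<close> by (simp add: f_def[abs_def] C_def diff_divide_distrib)
  obtain F where F: "\<And>t. (F has_vector_derivative f t) (at t)"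
    using einterval_antiderivative[of "-\<infinity>" \<infinity> f] fc
    by (auto simp: continuous_on_eq_continuous_at)
  then have F': "(F has_real_derivative f t) (at t)" for t
    by (simp add: has_real_derivative_iff_has_vector_derivative)
  have "(f has_integral (F 1 - F 0)) {0..1}"
    by (rule fundamental_theorem_of_calculus) (auto intro: F has_vector_derivative_at_within)
  from has_integral_unique[OF this fi] have F01: "F 1 = F 0" by simp
  have step: "F (t + 1) = F t" for t
  proof -
    have "((\<lambda>t. F (t + 1) - F t) has_real_derivative 0) (at t)" for t
    proof -
      have "((\<lambda>t. F (t + 1)) has_real_derivative f (t + 1)) (at t)"
        using DERIV_shift[of F "f (t + 1)" t 1] F' by simp
      from DERIV_diff[OF this F'[of t]] show ?thesis by (simp add: f_def per)
    qed
    then have "F (t + 1) - F t = F (0 + 1) - F 0"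
      using DERIV_isconst_all[of "\<lambda>t. F (t + 1) - F t"] by blast
    then show ?thesis using F01 by simp
  qed
  have nat: "F (t + real n) = F t" for t n
  proof (induction n)
    case (Suc n)
    have "t + real (Suc n) = (t + real n) + 1" by simp
    then show ?case using step[of "t + real n"] Suc by (simp only:)
  qed simp
  have int: "F (t + of_int n) = F t" for t n
  proof (cases n rule: int_cases2)
    case (nonneg m) then show ?thesis using nat by simp
  next
    case (nonpos m) then show ?thesis using nat[of "t - real m" m] by simp
  qed
  have "C\<^sup>2 = crit"
  proof (rule classical_solution_crit)
    show "int_periodic (\<lambda>y. F (y $ j))"
      unfolding int_periodic_def using int by (metis Ints_cases vector_add_component)
    fix y :: "real ^ 'm"
    have "(F has_derivative (\<lambda>h. h * f (y $ j))) (at (y $ j))"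
      using F'[of "y $ j"] unfolding has_field_derivative_def by (simp only: mult_commute_abs)
    moreover have "((\<lambda>y. y $ j) has_derivative (\<lambda>h. h $ j)) (at y)"
      by (intro bounded_linear.has_derivative[OF bounded_linear_vec_nth] has_derivative_ident)
    ultimately have "((\<lambda>y. F (y $ j)) has_derivative (\<lambda>h. h $ j * f (y $ j))) (at y)"
      using has_derivative_compose by blast
    then show "GDERIV (\<lambda>y. F (y $ j)) y :> axis j (f (y $ j))"
      by (simp add: gderiv_def inner_axis)
    show "ham y (axis j (f (y $ j))) = C\<^sup>2"
      using rnz by (simp add: ham f_def)
  qed
  then show ?thesis by (simp add: C_def power_divide r_def s_def)
qed

end

section \<open>The effective Hamiltonian\<close>

theorem proposition5p2:
  fixes \<sigma> :: "real ^ 'n \<Rightarrow> real ^ 'm \<Rightarrow> real ^ 'r ^ 'n"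
    and \<tau> :: "real ^ 'm \<Rightarrow> real ^ 'r ^ 'm"
    and \<theta> :: real
    and xb pb :: "real ^ 'n"
  assumes \<sigma>_bounded: "bounded (range (\<lambda>(x, y). \<sigma> x y))"
    and \<sigma>_lipschitz: "\<exists>L. L-lipschitz_on UNIV (\<lambda>(x, y). \<sigma> x y)"
    and \<sigma>_periodic: "\<And>x. int_periodic (\<sigma> x)"
    and \<tau>_lipschitz: "locally_lipschitz \<tau>"
    and \<tau>_periodic: "int_periodic \<tau>"
    and \<theta>_pos: "\<theta> > 0"
    and \<tau>_nondegenerate:
      "\<And>y \<xi>. \<xi> \<noteq> 0 \<Longrightarrow> (norm (transpose (\<tau> y) *v \<xi>))\<^sup>2 > \<theta> * (norm \<xi>)\<^sup>2"
  shows "(\<forall>\<epsilon>>0. \<forall>\<^sub>F \<delta> in at_right 0. \<forall>y.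
            \<bar>discounted_value \<sigma> \<tau> xb pb \<delta> y - ereal (effective_Hamiltonian \<sigma> \<tau> xb pb)\<bar> < ereal \<epsilon>)
    \<and> ((\<forall>x y. \<tau> y ** transpose (\<sigma> x y) = 0) \<longrightarrow>
         (\<exists>y. effective_Hamiltonian \<sigma> \<tau> xb pb = (norm (transpose (\<sigma> xb y) *v pb))\<^sup>2) \<and>
         (\<forall>y. (norm (transpose (\<sigma> xb y) *v pb))\<^sup>2 \<le> effective_Hamiltonian \<sigma> \<tau> xb pb))
    \<and> (CARD('n) = 1 \<and> CARD('m) = 1 \<and> CARD('r) = 1 \<and> (\<forall>x y i k. \<sigma> x y $ i $ k \<ge> 0) \<longrightarrow>
         (\<forall>(i :: 'n) (j :: 'm) (k :: 'r).
            effective_Hamiltonian \<sigma> \<tau> xb pb =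
              (integral {0..1} (\<lambda>s. \<sigma> xb (vec s) $ i $ k / \<tau> (vec s) $ j $ k))\<^sup>2 *
              (integral {0..1} (\<lambda>s. 1 / \<tau> (vec s) $ j $ k)) powi (- 2) *
              (pb $ i)\<^sup>2))"
proof -
  let ?b = "\<lambda>y. transpose (\<sigma> xb y) *v pb"
  obtain L where "L-lipschitz_on UNIV (\<lambda>(x, y). \<sigma> x y)" using \<sigma>_lipschitz by blast
  then have "continuous_on UNIV (\<lambda>(x, y). \<sigma> x y)" by (rule lipschitz_on_continuous_on)
  from continuous_on_compose2[OF this, of UNIV "\<lambda>y. (xb, y)"]
  have \<sigma>c: "continuous_on UNIV (\<sigma> xb)" by (simp add: continuous_on_Pair)
  have \<tau>c: "continuous_on UNIV \<tau>"
  proof (rule continuous_at_imp_continuous_on, rule ballI)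
    fix y
    obtain e M where e: "e > 0" "M-lipschitz_on (ball y e) \<tau>"
      using \<tau>_lipschitz unfolding locally_lipschitz_def by blast
    then show "isCont \<tau> y"
      using lipschitz_on_continuous_on[OF e(2)] continuous_on_interior[of "ball y e" \<tau> y] by simp
  qed
  interpret cell_problem ?b \<tau> \<theta>
  proof
    show "continuous_on UNIV ?b" by (intro continuous_intros \<sigma>c)
    show "int_periodic ?b" using \<sigma>_periodic[of xb] by (simp add: int_periodic_def)
  qed (use \<tau>c \<tau>_periodic \<theta>_pos \<tau>_nondegenerate in auto)
  have eff: "effective_Hamiltonian \<sigma> \<tau> xb pb = crit"
  proof -
    have "effective_Hamiltonian \<sigma> \<tau> xb pb =
        (THE H. \<exists>w. int_periodic w \<and> viscosity_solution (cell_op H) w)"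
      by (simp only: effective_Hamiltonian_def ham_def)
    then show ?thesis by (simp add: cell_constant_unique)
  qed
  have traj: "admissible_control \<beta> \<and> trajectory \<sigma> \<tau> xb pb \<beta> y Y \<longleftrightarrow> run \<beta> Y \<and> Y 0 = y" for \<beta> y Y
  proof -
    have "Y 0 = y" if "trajectory \<sigma> \<tau> xb pb \<beta> y Y"
    proof -
      have "((\<lambda>s. 2 *\<^sub>R (\<tau> (Y s) *v ?b (Y s)) - 2 *\<^sub>R (\<tau> (Y s) *v \<beta> s)) has_integral (Y 0 - y)) {0..0}"
        using that unfolding trajectory_def by (elim allE[of _ 0]) simp
      then have "((\<lambda>s. 2 *\<^sub>R (\<tau> (Y s) *v ?b (Y s)) - 2 *\<^sub>R (\<tau> (Y s) *v \<beta> s)) has_integral (Y 0 - y)) {0}"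
        by simp
      from has_integral_unique[OF this has_integral_refl(2)] show ?thesis by simp
    qed
    then show ?thesis
      unfolding admissible_control_iff run_def trajectory_def vel_def by blast
  qed
  have payoff: "discounted_payoff \<sigma> xb pb \<delta> \<beta> Y =
      ereal \<delta> * extended_integral (lebesgue_on {0..}) (payoff_density \<delta> \<beta> Y)" for \<delta> \<beta> Y
    by (simp only: discounted_payoff_def gain_def)
  \<comment> \<open>The larger one of the constants in \<open>payoff_le\<close> and \<open>payoff_ge\<close>.\<close>
  define A where "A = 7 * excess_bound + 3"
  have up: "discounted_value \<sigma> \<tau> xb pb \<delta> y \<le> ereal (crit + A * \<delta>)" if d: "\<delta> > 0" for \<delta> y
    unfolding discounted_value_def
  proof (rule SUP_least, clarify)
    fix \<beta> Y assume "admissible_control \<beta>" "trajectory \<sigma> \<tau> xb pb \<beta> y Y"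
    then have r: "run \<beta> Y" using traj by blast
    have "ereal \<delta> * extended_integral (lebesgue_on {0..}) (payoff_density \<delta> \<beta> Y)
        \<le> ereal \<delta> * ereal (crit / \<delta> + 2 * excess_bound)"
      using d by (intro ereal_mult_left_mono payoff_le[OF r d]) auto
    also have "\<dots> = ereal (crit + 2 * excess_bound * \<delta>)" using d by (simp add: distrib_left mult.commute)
    also have "\<dots> \<le> ereal (crit + A * \<delta>)" using d excess_bound_nonneg by (simp add: A_def)
    finally show "discounted_payoff \<sigma> xb pb \<delta> \<beta> Y \<le> ereal (crit + A * \<delta>)" by (simp only: payoff)
  qed
  have low: "ereal (crit - A * \<delta>) \<le> discounted_value \<sigma> \<tau> xb pb \<delta> y" if d: "\<delta> > 0" for \<delta> y
  proof -
    obtain \<beta> Y where r: "run \<beta> Y" "Y 0 = y"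
      "ereal (crit / \<delta> - (7 * excess_bound + 3)) \<le> extended_integral (lebesgue_on {0..}) (payoff_density \<delta> \<beta> Y)"
      by (rule payoff_ge[OF d])
    have "ereal (crit - A * \<delta>) = ereal \<delta> * ereal (crit / \<delta> - (7 * excess_bound + 3))"
      using d by (simp add: A_def right_diff_distrib mult.commute)
    also have "\<dots> \<le> discounted_payoff \<sigma> xb pb \<delta> \<beta> Y"
      unfolding payoff using d by (intro ereal_mult_left_mono r) auto
    also have "\<dots> \<le> discounted_value \<sigma> \<tau> xb pb \<delta> y"
      unfolding discounted_value_def using traj[of \<beta> y Y] r(1,2) by (intro SUP_upper2[of "(\<beta>, Y)"]) simp_all
    finally show ?thesis .
  qed
  have 1: "\<forall>\<^sub>F \<delta> in at_right 0. \<forall>y. \<bar>discounted_value \<sigma> \<tau> xb pb \<delta> y - ereal crit\<bar> < ereal \<epsilon>"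
    if e: "\<epsilon> > 0" for \<epsilon>
  proof -
    have A: "A > 0" using excess_bound_nonneg by (simp add: A_def)
    then have "\<forall>\<^sub>F \<delta> in at_right 0. 0 < \<delta> \<and> \<delta> < \<epsilon> / A"
      using e by (intro eventually_at_rightI[of 0 "\<epsilon> / A"]) auto
    then show ?thesis
    proof eventually_elim
      case (elim \<delta>)
      then show ?case
        using abs_ereal_diff_less[OF low up] A by (simp add: pos_less_divide_eq mult.commute)
    qed
  qed
  have 2: "(\<exists>y. crit = (norm (?b y))\<^sup>2) \<and> (\<forall>y. (norm (?b y))\<^sup>2 \<le> crit)"
    if "\<forall>x y. \<tau> y ** transpose (\<sigma> x y) = 0"
  proof -
    have "\<tau> y *v ?b y = 0" for y using that by (simp add: matrix_vector_mul_assoc)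
    then show ?thesis using crit_eq_max by blast
  qed
  have 3: "crit = (integral {0..1} (\<lambda>s. \<sigma> xb (vec s) $ i $ k / \<tau> (vec s) $ j $ k))\<^sup>2 *
      (integral {0..1} (\<lambda>s. 1 / \<tau> (vec s) $ j $ k)) powi (- 2) * (pb $ i)\<^sup>2"
    if card: "CARD('n) = 1" "CARD('m) = 1" "CARD('r) = 1" for i :: 'n and j :: 'm and k :: 'r
  proof -
    have U: "(UNIV :: 'n set) = {i}" "(UNIV :: 'm set) = {j}" "(UNIV :: 'r set) = {k}"
      using card by (metis card_1_singletonE UNIV_I singletonD)+
    let ?I = "integral {0..1} (\<lambda>s. 1 / \<tau> (vec s) $ j $ k)"
      and ?J = "integral {0..1} (\<lambda>s. \<sigma> xb (vec s) $ i $ k / \<tau> (vec s) $ j $ k)"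
    have "?b y $ k / c = pb $ i * (\<sigma> xb y $ i $ k / c)" for y c
      by (simp add: matrix_vector_mult_def transpose_def U(1))
    then have "crit = (pb $ i * ?J)\<^sup>2 / ?I\<^sup>2"
      using crit_one_dim[OF U(2,3)] by (simp only: integral_mult_right)
    moreover have "?I powi (- 2) = 1 / ?I\<^sup>2"
      by (simp add: power_int_minus inverse_eq_divide)
    ultimately show ?thesis by (simp add: power_mult_distrib mult.commute)
  qed
  show ?thesis unfolding eff using 1 2 3 by blast
qed

end
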